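(* Let $\delta>0$, let $V$, $U_N$, $H_N$, $\boldsymbol u^\pm$, $\boldsymbol u^s$, $S$, $B_\pm$, $\hat n$, $\lambda_j^s$, $\lambda_j^\pm$ be as defined in the context, with the concentration assumption stated there. Write $E_N^s=U_N(\boldsymbol u^s)$ and $E_N^\pm=U_N(\boldsymbol u^\pm)$. For $\beta>0$ let $$C_N=\int_{\mathbb{R}^{2N}}e^{-\beta H_N}\,d\boldsymbol p\,d\boldsymbol u,\quad C_N^\pm=\int_{B_\pm}e^{-\beta H_N}\,d\boldsymbol p\,d\boldsymbol u,\quad \nu_S^c=C_N^{-1}\int_S\max(\boldsymbol p\cdot\hat n,0)\,e^{-\beta H_N(\boldsymbol p,\boldsymbol u)}\,d\tilde\sigma(\boldsymbol p,\boldsymbol u),$$ where $d\tilde\sigma$ is the surface element on $S$, and define the mean residency times in $B_\pm$ by $\tau_\pm^c=\dfrac{C_N^\pm}{C_N\,\nu_S^c}$. Then for every integer $N\ge2$, as $\beta\to\infty$, $$\tau_\pm^c\ \sim\ 2\pi\,\frac{\prod_{j=2}^N\sqrt{\lambda_j^s}}{\prod_{j=1}^N\sqrt{\lambda_j^\pm}}\;e^{\beta(E_N^s-E_N^\pm)} .$$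
   Context: $V:\mathbb{R}\to\mathbb{R}$ is a smooth double-well potential, bounded below, with $V(u)\ge Cu^2$ for some $C>0$ as $|u|\to\infty$. For $\boldsymbol p,\boldsymbol u\in\mathbb{R}^N$, $$U_N(\boldsymbol u)=\frac1N\sum_{j=1}^NV(u_j)+N\sum_{j=0}^N\tfrac12\delta^2(u_{j+1}-u_j)^2,\qquad H_N(\boldsymbol p,\boldsymbol u)=\frac1{2N}\sum_{j=1}^Np_j^2+U_N(\boldsymbol u),$$ with either Dirichlet ($u_0=u_{N+1}=0$) or Neumann ($u_0=u_1$, $u_{N+1}=u_N$) boundary conditions. Saddle: $\boldsymbol u^s$ is the Morse index 1 critical point of $U_N$ of minimum energy, so that $0=\delta^2N^2(u^s_{j-1}-2u^s_j+u^s_{j+1})-V'(u^s_j)$. The eigenvalues $\lambda_1^s<0<\lambda_2^s<\dots<\lambda_N^s$ and eigenvectors $\boldsymbol\phi^{(k)}$ solve $$\lambda_k^s\phi_j^{(k)}=-\delta^2N^2\big(\phi_{j-1}^{(k)}-2\phi_j^{(k)}+\phi_{j+1}^{(k)}\big)+V''(u_j^s)\phi_j^{(k)},\qquad j=1,\dots,N,$$ with the same boundary conditions (Dirichlet or Neumann) as $\boldsymbol u$. The dividing surface and the two regions are $$S=\{(\boldsymbol p,\boldsymbol u)\in\mathbb{R}^{2N}:(\boldsymbol u-\boldsymbol u^s)\cdot\boldsymbol\phi^{(1)}=0\},\quad B_\pm=\{(\boldsymbol p,\boldsymbol u)\in\mathbb{R}^{2N}:\pm(\boldsymbol u-\boldsymbol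 u^s)\cdot\boldsymbol\phi^{(1)}>0\},$$ and $\hat n=\boldsymbol\phi^{(1)}/|\boldsymbol\phi^{(1)}|\in\mathbb{R}^N$ is the unit normal to $\{\boldsymbol u:(\boldsymbol u-\boldsymbol u^s)\cdot\boldsymbol\phi^{(1)}=0\}$. ($\nu_S^c$ is the transition state theory mean frequency of crossings of $S$ from $B_-$ to $B_+$ under the Hamiltonian dynamics with initial conditions drawn from the canonical measure $C_N^{-1}e^{-\beta H_N}d\boldsymbol p\,d\boldsymbol u$.) Minimizers: $\boldsymbol u^+$ and $\boldsymbol u^-$ are the two minimizers of $U_N$, with $(\boldsymbol 0,\boldsymbol u^+)\in B_+$ and $(\boldsymbol 0,\boldsymbol u^-)\in B_-$ (each region contains exactly one). The eigenvalues $0<\lambda_1^\pm<\dots<\lambda_N^\pm$ solve $$\lambda_k^\pm\psi_j^{(k)\pm}=-\delta^2N^2\big(\psi_{j-1}^{(k)\pm}-2\psi_j^{(k)\pm}+\psi_{j+1}^{(k)\pm}\big)+V''(u_j^\pm)\psi_j^{(k)\pm},\qquad j=1,\dots,N,$$ with the same boundary conditions. Concentration assumption: the canonical measure is concentrated, up to exponentially small mass as $\beta\to\infty$, near $\boldsymbol u^s$ on $S$ and near $\boldsymbol u^\pm$ in $B_\pm$. That is, for every $\varepsilon>0$ there are $K,c,\beta_0>0$ such that for all $\beta>\beta_0$ the fraction of the total mass of $e^{-\beta U_N}$ (with respect to surface measure) on the hyperplane $\{\boldsymbol u:(\boldsymbol u-\boldsymbol u^s)\cdot\boldsymbol\phi^{(1)}=0\}$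 that lies in $\{|\boldsymbol u-\boldsymbol u^s|>\varepsilon\}$ is at most $Ke^{-c\beta}$, and likewise the fraction of the total mass of $e^{-\beta U_N}\,d\boldsymbol u$ on $\{\boldsymbol u:\pm(\boldsymbol u-\boldsymbol u^s)\cdot\boldsymbol\phi^{(1)}>0\}$ that lies in $\{|\boldsymbol u-\boldsymbol u^\pm|>\varepsilon\}$ is at most $Ke^{-c\beta}$. $f\sim g$ as $\beta\to\infty$ means $f/g\to1$. *)

theory Defs
  imports "HOL-Analysis.Analysis" "HOL-Library.Landau_Symbols"
begin

section \<open>The potential\<close>

definition smooth_fun :: "(real \<Rightarrow> real) \<Rightarrow> bool" where
  "smooth_fun V \<longleftrightarrow> (\<forall>k x. (deriv ^^ k) V differentiable (at x))"

definition local_minimizer :: "('a::topological_space \<Rightarrow> real) \<Rightarrow> 'a \<Rightarrow> bool" where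
  "local_minimizer f x \<longleftrightarrow> (\<forall>\<^sub>F y in nhds x. f x \<le> f y)"

text \<open>The wells may have different depths.  For continuous \<open>V\<close>, having exactly two local
  minimizers forces a single barrier between them.\<close>

definition double_well :: "(real \<Rightarrow> real) \<Rightarrow> bool" where
  "double_well V \<longleftrightarrow> (\<exists>a b. a < b \<and> {x. local_minimizer V x} = {a, b})"


section \<open>The discretized energy\<close>

datatype boundary = Dirichlet | Neumann

text \<open>Configurations are vectors in \<open>real ^ 'n\<close>, with \<open>N = CARD('n)\<close>.  The function \<open>site\<close>
  (in use a bijection from \<open>{1..N}\<close> to \<open>'n\<close>) enumerates the lattice sites in their order along the
  chain, so that the component \<open>u\<^sub>j\<close> is \<open>u $ site j\<close>.  The value of \<open>extend bc site u j\<close> is \<open>u\<^sub>j\<close>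
  for \<open>0 \<le> j \<le> N + 1\<close>, where \<open>u\<^sub>0\<close> and \<open>u\<^sub>N\<^sub>+\<^sub>1\<close> are given by the boundary conditions.\<close>

definition extend :: "boundary \<Rightarrow> (nat \<Rightarrow> 'n::finite) \<Rightarrow> real ^ 'n \<Rightarrow> nat \<Rightarrow> real" where
  "extend bc site u j =
    (if 1 \<le> j \<and> j \<le> CARD('n) then u $ site j
     else (case bc of
             Dirichlet \<Rightarrow> 0
           | Neumann \<Rightarrow> if j = 0 then u $ site 1 else u $ site CARD('n)))"

definition potential_energy ::
  "boundary \<Rightarrow> (nat \<Rightarrow> 'n::finite) \<Rightarrow> real \<Rightarrow> (real \<Rightarrow> real) \<Rightarrow> real ^ 'n \<Rightarrow> real" where
  "potential_energy bc site \<delta> V u =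
    1 / real CARD('n) * (\<Sum>j = 1..CARD('n). V (u $ site j)) +
    real CARD('n) *
      (\<Sum>j = 0..CARD('n). 1 / 2 * \<delta>\<^sup>2 * (extend bc site u (j + 1) - extend bc site u j)\<^sup>2)"

definition hamiltonian ::
  "(real ^ 'n::finite \<Rightarrow> real) \<Rightarrow> (real ^ 'n) \<times> (real ^ 'n) \<Rightarrow> real" where
  "hamiltonian U = (\<lambda>(p, u). 1 / (2 * real CARD('n)) * (\<Sum>j\<in>UNIV. (p $ j)\<^sup>2) + U u)"


section \<open>Critical points, Morse index and linearization\<close>

definition critical_point :: "('a::real_normed_vector \<Rightarrow> real) \<Rightarrow> 'a \<Rightarrow> bool" where
  "critical_point f x \<longleftrightarrow> (f has_derivative (\<lambda>h. 0)) (at x)"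

definition hessian :: "('a::real_normed_vector \<Rightarrow> real) \<Rightarrow> 'a \<Rightarrow> 'a \<Rightarrow> 'a \<Rightarrow> real" where
  "hessian f x v w = frechet_derivative (\<lambda>y. frechet_derivative f (at y) w) (at x) v"

definition morse_index :: "('a::euclidean_space \<Rightarrow> real) \<Rightarrow> 'a \<Rightarrow> nat" where
  "morse_index f x = Max {dim W | W. subspace W \<and> (\<forall>w\<in>W. w \<noteq> 0 \<longrightarrow> hessian f x w w < 0)}"

definition min_energy_saddle :: "('a::euclidean_space \<Rightarrow> real) \<Rightarrow> 'a \<Rightarrow> bool" where
  "min_energy_saddle f x \<longleftrightarrow> critical_point f x \<and> morse_index f x = 1 \<and>
     (\<forall>y. critical_point f y \<and> morse_index f y = 1 \<longrightarrow> f x \<le> f y)"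

definition eigenpair ::
  "boundary \<Rightarrow> (nat \<Rightarrow> 'n::finite) \<Rightarrow> real \<Rightarrow> (real \<Rightarrow> real) \<Rightarrow> real ^ 'n \<Rightarrow>
   real \<Rightarrow> real ^ 'n \<Rightarrow> bool" where
  "eigenpair bc site \<delta> V u l \<phi> \<longleftrightarrow> \<phi> \<noteq> 0 \<and>
    (\<forall>j\<in>{1..CARD('n)}.
       l * \<phi> $ site j =
         - (\<delta>\<^sup>2) * (real CARD('n))\<^sup>2 *
             (extend bc site \<phi> (j - 1) - 2 * extend bc site \<phi> j + extend bc site \<phi> (j + 1)) +
         deriv (deriv V) (u $ site j) * \<phi> $ site j)"

text \<open>All \<open>N\<close> eigenvalues \<open>l 1 < \<dots> < l N\<close> of the linearization at \<open>u\<close>, with eigenvectors.\<close>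

definition spectrum_at ::
  "boundary \<Rightarrow> (nat \<Rightarrow> 'n::finite) \<Rightarrow> real \<Rightarrow> (real \<Rightarrow> real) \<Rightarrow> real ^ 'n \<Rightarrow>
   (nat \<Rightarrow> real) \<Rightarrow> (nat \<Rightarrow> real ^ 'n) \<Rightarrow> bool" where
  "spectrum_at bc site \<delta> V u l \<phi> \<longleftrightarrow>
    strict_mono_on {1..CARD('n)} l \<and>
    (\<forall>k\<in>{1..CARD('n)}. eigenpair bc site \<delta> V u (l k) (\<phi> k))"


section \<open>Surface measure on a hyperplane\<close>

definition hyperplane :: "'a::euclidean_space \<Rightarrow> 'a \<Rightarrow> 'a set" where
  "hyperplane a n = {x. (x - a) \<bullet> n = 0}"

definition orthonormal_basis_of :: "'a::euclidean_space set \<Rightarrow> 'a set \<Rightarrow> bool" where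
  "orthonormal_basis_of W B \<longleftrightarrow>
     pairwise orthogonal B \<and> (\<forall>b\<in>B. norm b = 1) \<and> span B = W"

lemma orthonormal_basis_of_exists:
  assumes "subspace (W :: 'a::euclidean_space set)"
  shows "\<exists>B. orthonormal_basis_of W B"
  using orthonormal_basis_subspace[OF assms] unfolding orthonormal_basis_of_def by metis

text \<open>The surface element of a hyperplane is Lebesgue measure of one dimension less, transported by
  the isometric parametrization \<open>q \<mapsto> a + (\<Sum>b\<in>B. q b *\<^sub>R b)\<close>, with \<open>B\<close> an orthonormal basis of the
  space of tangent directions (compare \<open>lborel_eq\<close>).  By rotation invariance of Lebesgue measure
  the choice of \<open>B\<close> is immaterial.  The measure lives on the ambient space and is carried by
  \<open>hyperplane a n\<close>.\<close>

definition hyperplane_measure :: "'a::euclidean_space \<Rightarrow> 'a \<Rightarrow> 'a measure" where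
  "hyperplane_measure a n =
    (let B = (SOME B. orthonormal_basis_of {x. x \<bullet> n = 0} B)
     in distr (\<Pi>\<^sub>M b\<in>B. lborel) borel (\<lambda>q. a + (\<Sum>b\<in>B. q b *\<^sub>R b)))"


section \<open>Dividing surface, regions and residency times\<close>

definition dividing_surface ::
  "real ^ 'n::finite \<Rightarrow> real ^ 'n \<Rightarrow> ((real ^ 'n) \<times> (real ^ 'n)) set" where
  "dividing_surface us \<phi> = {(p, u). (u - us) \<bullet> \<phi> = 0}"

text \<open>Here and below \<open>s = 1\<close> and \<open>s = -1\<close> give the objects with subscript \<open>+\<close> and \<open>-\<close>.\<close>

definition half_space :: "real \<Rightarrow> real ^ 'n::finite \<Rightarrow> real ^ 'n \<Rightarrow> (real ^ 'n) set" where
  "half_space s us \<phi> = {u. s * ((u - us) \<bullet> \<phi>) > 0}"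

definition region ::
  "real \<Rightarrow> real ^ 'n::finite \<Rightarrow> real ^ 'n \<Rightarrow> ((real ^ 'n) \<times> (real ^ 'n)) set" where
  "region s us \<phi> = {(p, u). s * ((u - us) \<bullet> \<phi>) > 0}"

lemma dividing_surface_eq_hyperplane: "dividing_surface us \<phi> = hyperplane (0, us) (0, \<phi>)"
  by (auto simp: dividing_surface_def hyperplane_def)

definition surface_element ::
  "real ^ 'n::finite \<Rightarrow> real ^ 'n \<Rightarrow> ((real ^ 'n) \<times> (real ^ 'n)) measure" where
  "surface_element us \<phi> = hyperplane_measure (0, us) (0, \<phi>)"

definition partition_fun ::
  "(real ^ 'n::finite \<Rightarrow> real) \<Rightarrow> real \<Rightarrow> ((real ^ 'n) \<times> (real ^ 'n)) set \<Rightarrow> real" where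
  "partition_fun U \<beta> A = (LINT (p, u):A|lborel. exp (- \<beta> * hamiltonian U (p, u)))"

definition crossing_frequency ::
  "(real ^ 'n::finite \<Rightarrow> real) \<Rightarrow> real ^ 'n \<Rightarrow> real ^ 'n \<Rightarrow> real \<Rightarrow> real" where
  "crossing_frequency U us \<phi> \<beta> =
    (LINT (p, u):dividing_surface us \<phi>|surface_element us \<phi>.
       max (p \<bullet> (\<phi> /\<^sub>R norm \<phi>)) 0 * exp (- \<beta> * hamiltonian U (p, u)))
    / partition_fun U \<beta> UNIV"

definition residency_time ::
  "(real ^ 'n::finite \<Rightarrow> real) \<Rightarrow> real ^ 'n \<Rightarrow> real ^ 'n \<Rightarrow> real \<Rightarrow> real \<Rightarrow> real" where
  "residency_time U us \<phi> s \<beta> =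
    partition_fun U \<beta> (region s us \<phi>) / (partition_fun U \<beta> UNIV * crossing_frequency U us \<phi> \<beta>)"

text \<open>The measure with density \<open>exp (- \<beta> U)\<close> with respect to \<open>M\<close>, restricted to \<open>A\<close>, is
  exponentially concentrated near \<open>x0\<close> as \<open>\<beta> \<rightarrow> \<infinity>\<close>.\<close>

definition concentrates ::
  "'a::euclidean_space measure \<Rightarrow> 'a set \<Rightarrow> ('a \<Rightarrow> real) \<Rightarrow> 'a \<Rightarrow> bool" where
  "concentrates M A U x0 \<longleftrightarrow>
    (\<forall>\<epsilon>>0. \<exists>K>0. \<exists>c>0. \<exists>\<beta>0>0. \<forall>\<beta>>\<beta>0.
       (LINT u:A \<inter> {u. norm (u - x0) > \<epsilon>}|M. exp (- \<beta> * U u)) / (LINT u:A|M. exp (- \<beta> * U u))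
         \<le> K * exp (- c * \<beta>))"

end

theory Submission
  imports Defs "HOL-Probability.Distributions"
begin

text \<open>The momentum integrals factor out of both the numerator and the flux through the dividing
  surface; their ratio is \<open>sqrt (2 * pi * \<beta> / N)\<close>, because all directions except the normal one
  cancel.  What remains is a quotient of configuration integrals, over a half-space and over a
  hyperplane.  By the concentration hypotheses only small neighbourhoods of the minimizer and of
  the saddle matter, and there Laplace's method (rescaling by \<open>1 / sqrt \<beta>\<close> and dominated
  convergence) gives Gaussian integrals.  The Hessian of the energy is \<open>1 / N\<close> times the linearized
  operator, so in an orthonormal basis of eigenvectors these are products of \<open>sqrt (2 * pi * N / l j)\<close>;
  on the hyperplane the unstable direction is missing.\<close>

section \<open>Lebesgue measure in orthonormal coordinates\<close>

text \<open>Both configuration integrals are to come out of one volume Laplace lemma, but the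
  surface measure is a product measure pushed forward along a basis picked by \<open>SOME\<close>.
  Smearing over the normal coordinate removes this obstacle, and a Gaussian weight of variance
  1/beta fits best: exp (- beta t^2 / 2) acts as an extra energy term, with eigenvalue 1 along the
  normal in place of the negative one.

  Concentration bounds the far region as a fraction of the total, so only the near region needs an
  estimate; coercivity serves integrability. The dominating function has q/4 in the exponent where
  the limit has q/2: the difference absorbs the Taylor remainder.

  Apart from the exponentials, the volume integral scales like beta^(-N/2), the surface integral
  like beta^(-(N-1)/2), and the momentum ratio supplies the missing sqrt beta. The factors N balance
  as well: each direction contributes r / sqrt l with r = sqrt (2 pi N), one r is left over, and
  sqrt (2 pi / N) * r = 2 pi.\<close>

lemma lborel_distr_orthogonal:
  fixes f :: "'a::euclidean_space \<Rightarrow> 'a"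
  assumes f: "orthogonal_transformation f"
  shows "distr lborel borel f = lborel"
proof -
  interpret lborel_pair: pair_sigma_finite "lborel::'a measure" "lborel::'a measure" ..
  have lin: "linear f" using f by (rule orthogonal_transformation_linear)
  have [measurable]: "f \<in> borel_measurable borel"
    using lin by (intro borel_measurable_continuous_onI linear_continuous_on) (simp add: linear_conv_bounded_linear)
  obtain g where g: "\<And>x. f (g x) = x" "\<And>x. g (f x) = x" and og: "orthogonal_transformation g"
    using orthogonal_transformation_bij[OF f] orthogonal_transformation_inv[OF f]
    by (metis bij_inv_eq_iff)
  have shift: "(\<integral>\<^sup>+x. h (x + c) \<partial>lborel) = (\<integral>\<^sup>+x. h x \<partial>lborel)"
    if [measurable]: "h \<in> borel_measurable borel" for h :: "'a \<Rightarrow> ennreal" and c :: 'a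
  proof -
    have "(\<integral>\<^sup>+x. h x \<partial>lborel) = (\<integral>\<^sup>+x. h x \<partial>(distr lborel borel ((+) c)))"
      by (simp add: lborel_distr_plus)
    then show ?thesis by (simp add: nn_integral_distr add.commute)
  qed
  have [measurable]: "ball (0::'a) 1 \<in> sets borel" by simp
  \<comment> \<open>Uniqueness of translation-invariant measure, replayed by averaging over the unit
    ball: \<open>v\<close> times the measure of the preimage of \<open>A\<close> is a double
    integral, translations and Fubini turn it into an integral over \<open>A\<close>, and the inner
    integral is again the volume of a unit ball because \<open>f\<close> is an isometry.\<close>
  define v where "v = emeasure lborel (ball (0::'a) 1)"
  have v: "emeasure lborel (ball c 1) = v" for c :: 'a
    unfolding v_def by (simp add: emeasure_ball)
  have v_fin: "v \<noteq> \<infinity>" "v \<noteq> 0"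
    using content_ball_pos[of 1 "0::'a"] emeasure_lborel_ball_finite[of "0::'a" 1]
    by (auto simp: v_def measure_def)
  show ?thesis
  proof (rule measure_eqI)
    fix A assume "A \<in> sets (distr lborel borel f)"
    then have [measurable]: "A \<in> sets borel" by simp
    have "emeasure (distr lborel borel f) A = (\<integral>\<^sup>+x. indicator A x \<partial>distr lborel borel f)" by simp
    also have "\<dots> = (\<integral>\<^sup>+x. indicator A (f x) \<partial>lborel)" by (rule nn_integral_distr) auto
    finally have eA: "emeasure (distr lborel borel f) A = (\<integral>\<^sup>+x. indicator A (f x) \<partial>lborel)" .
    have "v * emeasure (distr lborel borel f) A
      = (\<integral>\<^sup>+y. indicator (ball (0::'a) 1) y * (\<integral>\<^sup>+x. indicator A (f x) \<partial>lborel) \<partial>lborel)"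
    proof -
      have "(\<lambda>y. indicator (ball 0 1) y :: ennreal) \<in> borel_measurable (lborel :: 'a measure)"
        by (intro borel_measurable_indicator) simp
      then show ?thesis
        by (subst nn_integral_multc) (auto simp: v_def eA)
    qed
    also have "\<dots> = (\<integral>\<^sup>+y. \<integral>\<^sup>+x. indicator (ball (0::'a) 1) y * indicator A (f x + y) \<partial>lborel \<partial>lborel)"
    \<comment> \<open>Translating \<open>x\<close> by \<open>g y\<close> leaves the integral
      unchanged and turns \<open>f x\<close> into \<open>f x + y\<close>.\<close>
    proof (rule nn_integral_cong)
      fix y :: 'a
      have "(\<integral>\<^sup>+x. indicator A (f x) \<partial>lborel) = (\<integral>\<^sup>+x. indicator A (f (x + g y)) \<partial>lborel)"
        by (subst shift) auto
      then show "indicator (ball 0 1) y * (\<integral>\<^sup>+x. indicator A (f x) \<partial>lborel)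
          = (\<integral>\<^sup>+x. indicator (ball 0 1) y * indicator A (f x + y) \<partial>lborel)"
        by (subst nn_integral_cmult) (auto simp: linear_add[OF lin] g)
    qed
    also have "\<dots> = (\<integral>\<^sup>+x. \<integral>\<^sup>+y. indicator (ball (0::'a) 1) y * indicator A (f x + y) \<partial>lborel \<partial>lborel)"
      by (rule lborel_pair.Fubini') measurable
    also have "\<dots> = (\<integral>\<^sup>+x. \<integral>\<^sup>+z. indicator (ball 0 1) (z - f x) * indicator A z \<partial>lborel \<partial>lborel)"
    proof (rule nn_integral_cong)
      fix x :: 'a
      show "(\<integral>\<^sup>+y. indicator (ball 0 1) y * indicator A (f x + y) \<partial>lborel)
        = (\<integral>\<^sup>+z. indicator (ball 0 1) (z - f x) * indicator A z \<partial>lborel)"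
        using shift[of "\<lambda>z. indicator (ball 0 1) (z - f x) * indicator A z" "f x"]
        by (simp add: add.commute)
    qed
    also have "\<dots> = (\<integral>\<^sup>+z. \<integral>\<^sup>+x. indicator (ball 0 1) (z - f x) * indicator A z \<partial>lborel \<partial>lborel)"
      by (rule lborel_pair.Fubini') measurable
    also have "\<dots> = (\<integral>\<^sup>+z. v * indicator A z \<partial>lborel)"
    proof (rule nn_integral_cong)
      fix z :: 'a
      have "norm (z - f x) = dist (g z) x" for x
        using orthogonal_transformation_norm[OF f, of "g z - x"]
        by (simp add: dist_norm linear_diff[OF lin] g)
      then have "(\<integral>\<^sup>+x. indicator (ball 0 1) (z - f x) \<partial>lborel) = (\<integral>\<^sup>+x. indicator (ball (g z) 1) x \<partial>lborel)"
        by (intro nn_integral_cong) (auto simp: indicator_def)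
      then show "(\<integral>\<^sup>+x. indicator (ball 0 1) (z - f x) * indicator A z \<partial>lborel) = v * indicator A z"
        by (simp add: nn_integral_multc v)
    qed
    also have "\<dots> = v * emeasure lborel A" by (simp add: nn_integral_cmult)
    finally show "emeasure (distr lborel borel f) A = emeasure lborel A"
      using v_fin by (simp add: ennreal_mult_cancel_left)
  qed simp
qed

section \<open>Coordinates with respect to an orthonormal basis\<close>

lemma orthonormal_basis_ofD:
  assumes "orthonormal_basis_of W B"
  shows "finite B" "independent B" "\<And>b c. b \<in> B \<Longrightarrow> c \<in> B \<Longrightarrow> b \<bullet> c = (if b = c then 1 else 0)"
proof -
  have B: "pairwise orthogonal B" "\<And>b. b \<in> B \<Longrightarrow> norm b = 1"
    using assms by (auto simp: orthonormal_basis_of_def)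
  show "independent B" using B by (intro pairwise_orthogonal_independent) force+
  then show "finite B" by (rule independent_imp_finite)
  show "b \<bullet> c = (if b = c then 1 else 0)" if "b \<in> B" "c \<in> B" for b c
    using B that by (auto simp: pairwise_def orthogonal_def norm_eq_1)
qed

lemma orthonormal_basis_of_sum_inner:
  assumes B: "orthonormal_basis_of W B" and c: "c \<in> B"
  shows "(\<Sum>b\<in>B. q b *\<^sub>R b) \<bullet> c = q c"
proof -
  note D = orthonormal_basis_ofD[OF B]
  have "(\<Sum>b\<in>B. q b *\<^sub>R b) \<bullet> c = (\<Sum>b\<in>B. if b = c then q b else 0)"
    unfolding inner_sum_left using c by (intro sum.cong) (auto simp: D(3))
  then show ?thesis using c D(1) by simp
qed

lemma orthonormal_basis_of_expand:
  assumes B: "orthonormal_basis_of W B" and x: "x \<in> W"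
  shows "(\<Sum>b\<in>B. (x \<bullet> b) *\<^sub>R b) = x"
proof -
  note D = orthonormal_basis_ofD[OF B]
  have "x \<in> span B" using B x by (simp add: orthonormal_basis_of_def)
  then obtain u where u: "x = (\<Sum>b\<in>B. u b *\<^sub>R b)"
    using span_finite[OF D(1)] by auto
  then show ?thesis using orthonormal_basis_of_sum_inner[OF B] by simp
qed

lemma orthonormal_basis_of_inner:
  assumes B: "orthonormal_basis_of W B" and x: "x \<in> W"
  shows "x \<bullet> y = (\<Sum>b\<in>B. (x \<bullet> b) * (y \<bullet> b))"
proof -
  have "x \<bullet> y = (\<Sum>b\<in>B. (x \<bullet> b) *\<^sub>R b) \<bullet> y"
    by (simp only: orthonormal_basis_of_expand[OF B x])
  then show ?thesis by (simp add: inner_sum_left inner_commute[of y])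
qed

text \<open>An orthogonal map \<open>f\<close> carrying \<open>Basis\<close> to \<open>B\<close>
  makes the coordinates of \<open>f x\<close> along \<open>B\<close> the standard coordinates of
  \<open>x\<close>. Since \<open>f\<close> preserves \<open>lborel\<close>, measurable boxes get the
  product measure, and boxes determine it.\<close>

lemma PiM_lborel_orthonormal_basis:
  fixes B :: "'a::euclidean_space set"
  assumes B: "orthonormal_basis_of UNIV B"
  shows "distr lborel (\<Pi>\<^sub>M b\<in>B. lborel) (\<lambda>x. \<lambda>b\<in>B. x \<bullet> b) = (\<Pi>\<^sub>M b\<in>B. lborel)"
proof -
  interpret product_sigma_finite "\<lambda>_::'a. lborel::real measure" ..
  note D = orthonormal_basis_ofD[OF B]
  have [measurable]: "(\<lambda>x. \<lambda>b\<in>B. x \<bullet> b) \<in> lborel \<rightarrow>\<^sub>M (\<Pi>\<^sub>M b\<in>B. lborel)"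
    by (intro measurable_restrict) simp
  have "card B = DIM('a)"
    using D(2) B dim_eq_card[of B UNIV] by (simp add: orthonormal_basis_of_def)
  then obtain g where g: "bij_betw g (Basis::'a set) B"
    using finite_same_card_bij[OF finite_Basis D(1)] by auto
  define f where "f x = (\<Sum>i\<in>Basis. (x \<bullet> i) *\<^sub>R g i)" for x :: 'a
  have gB: "g i \<in> B" if "i \<in> Basis" for i using g that by (auto simp: bij_betw_def)
  have fg: "f x \<bullet> g j = x \<bullet> j" if "j \<in> Basis" for x j
  proof -
    have "f x \<bullet> g j = (\<Sum>i\<in>Basis. if i = j then x \<bullet> i else 0)"
      unfolding f_def inner_sum_left using g that
      by (intro sum.cong) (auto simp: D(3) gB bij_betw_def inj_on_eq_iff)
    then show ?thesis using that by simp
  qed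
  have lin: "linear f"
    unfolding f_def by (intro linear_compose_sum ballI linearI) (auto simp: inner_simps algebra_simps)
  have "f x \<bullet> f y = x \<bullet> y" for x y
  proof -
    have "f x \<bullet> f y = (\<Sum>i\<in>Basis. (y \<bullet> i) * (f x \<bullet> g i))"
      by (subst (2) f_def) (simp add: inner_sum_right)
    then show ?thesis by (simp add: fg euclidean_inner[of x y] mult.commute)
  qed
  then have orth: "orthogonal_transformation f" using lin by (simp add: orthogonal_transformation_def)
  have [measurable]: "f \<in> borel_measurable borel" unfolding f_def by measurable
  show ?thesis
  proof (rule PiM_eqI[OF D(1)])
    fix A :: "'a \<Rightarrow> real set" assume "\<And>b. b \<in> B \<Longrightarrow> A b \<in> sets lborel"
    then have [measurable]: "b \<in> B \<Longrightarrow> A b \<in> sets borel" for b by simp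
    have [measurable]: "Pi\<^sub>E B A \<in> sets (\<Pi>\<^sub>M b\<in>B. lborel)"
      using D(1) by (intro sets_PiM_I_finite) auto
    have *: "restrict (\<lambda>b. f x \<bullet> b) B \<in> Pi\<^sub>E B A \<longleftrightarrow> (\<forall>i\<in>Basis. x \<bullet> i \<in> A (g i))" for x
      using g by (auto simp: PiE_iff fg bij_betw_def)
    have "emeasure (distr lborel (\<Pi>\<^sub>M b\<in>B. lborel) (\<lambda>x. \<lambda>b\<in>B. x \<bullet> b)) (Pi\<^sub>E B A)
       = (\<integral>\<^sup>+x. indicator (Pi\<^sub>E B A) (\<lambda>b\<in>B. x \<bullet> b) \<partial>lborel)"
      by (simp add: nn_integral_distr flip: nn_integral_indicator)
    also have "\<dots> = (\<integral>\<^sup>+x. indicator (Pi\<^sub>E B A) (\<lambda>b\<in>B. f x \<bullet> b) \<partial>lborel)"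
      by (subst lborel_distr_orthogonal[OF orth, symmetric]) (simp add: nn_integral_distr)
    also have "\<dots> = (\<integral>\<^sup>+x. (\<Prod>i\<in>Basis. indicator (A (g i)) (x \<bullet> i)) \<partial>lborel)"
    proof (rule nn_integral_cong)
      fix x :: 'a
      show "indicator (Pi\<^sub>E B A) (\<lambda>b\<in>B. f x \<bullet> b) = (\<Prod>i\<in>Basis. indicator (A (g i)) (x \<bullet> i) :: ennreal)"
        using * by (cases "\<forall>i\<in>Basis. x \<bullet> i \<in> A (g i)")
          (auto intro!: prod.neutral[symmetric] prod_zero[symmetric] simp: indicator_eq_0_iff)
    qed
    also have "\<dots> = (\<Prod>i\<in>Basis. emeasure lborel (A (g i)))"
      by (subst nn_integral_lborel_prod) (auto simp: gB)
    also have "\<dots> = (\<Prod>b\<in>B. emeasure lborel (A b))"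
      by (rule prod.reindex_bij_betw[OF g])
    finally show "emeasure (distr lborel (\<Pi>\<^sub>M b\<in>B. lborel) (\<lambda>x. \<lambda>b\<in>B. x \<bullet> b)) (Pi\<^sub>E B A)
      = (\<Prod>b\<in>B. emeasure lborel (A b))" .
  qed simp
qed

lemma nn_integral_lborel_orthonormal_basis:
  fixes B :: "'a::euclidean_space set"
  assumes B: "orthonormal_basis_of UNIV B" and [measurable]: "h \<in> borel_measurable borel"
  shows "(\<integral>\<^sup>+x. h x \<partial>lborel) = (\<integral>\<^sup>+q. h (\<Sum>b\<in>B. q b *\<^sub>R b) \<partial>(\<Pi>\<^sub>M b\<in>B. lborel))"
proof -
  have [measurable]: "(\<lambda>x. \<lambda>b\<in>B. x \<bullet> b) \<in> lborel \<rightarrow>\<^sub>M (\<Pi>\<^sub>M b\<in>B. lborel)"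
    by (intro measurable_restrict) simp
  have "(\<integral>\<^sup>+q. h (\<Sum>b\<in>B. q b *\<^sub>R b) \<partial>(\<Pi>\<^sub>M b\<in>B. lborel))
    = (\<integral>\<^sup>+x. h (\<Sum>b\<in>B. (\<lambda>b\<in>B. x \<bullet> b) b *\<^sub>R b) \<partial>lborel)"
    by (subst PiM_lborel_orthonormal_basis[OF B, symmetric]) (subst nn_integral_distr, auto)
  also have "\<dots> = (\<integral>\<^sup>+x. h x \<partial>lborel)"
    by (simp add: orthonormal_basis_of_expand[OF B] cong: sum.cong)
  finally show ?thesis by simp
qed

text \<open>Tonelli in the basis \<open>B\<close>; it splits Gaussians with a diagonal quadratic
  form into one-dimensional factors.\<close>

lemma nn_integral_lborel_prod_orthonormal_basis:
  fixes B :: "'a::euclidean_space set"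
  assumes B: "orthonormal_basis_of UNIV B"
    and f [measurable]: "\<And>b. b \<in> B \<Longrightarrow> f b \<in> borel_measurable borel"
  shows "(\<integral>\<^sup>+x. (\<Prod>b\<in>B. f b (x \<bullet> b)) \<partial>lborel) = (\<Prod>b\<in>B. \<integral>\<^sup>+t. f b t \<partial>(lborel::real measure))"
proof -
  interpret product_sigma_finite "\<lambda>_::'a. lborel::real measure" ..
  note D = orthonormal_basis_ofD[OF B]
  have "(\<integral>\<^sup>+x. (\<Prod>b\<in>B. f b (x \<bullet> b)) \<partial>lborel) = (\<integral>\<^sup>+q. (\<Prod>b\<in>B. f b (q b)) \<partial>(\<Pi>\<^sub>M b\<in>B. lborel))"
    by (subst nn_integral_lborel_orthonormal_basis[OF B])
       (auto simp: orthonormal_basis_of_sum_inner[OF B] cong: prod.cong)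
  then show ?thesis by (simp add: product_nn_integral_prod D(1))
qed

lemma orthonormal_basis_of_insert_normal:
  fixes n :: "'a::euclidean_space"
  assumes B: "orthonormal_basis_of {x. x \<bullet> n = 0} B" and n: "norm n = 1"
  shows "orthonormal_basis_of UNIV (insert n B)" "n \<notin> B"
proof -
  have Bn: "b \<bullet> n = 0" if "b \<in> B" for b
    using B that span_base[of b B] by (auto simp: orthonormal_basis_of_def)
  show "n \<notin> B" using Bn n by (force simp: norm_eq_1)
  have "x \<in> span (insert n B)" for x
  proof -
    have "x - (x \<bullet> n) *\<^sub>R n \<in> span B"
      using B n by (simp add: orthonormal_basis_of_def inner_simps norm_eq_1)
    then show ?thesis by (auto simp: span_insert)
  qed
  then show "orthonormal_basis_of UNIV (insert n B)"
    using B n Bn by (auto simp: orthonormal_basis_of_def pairwise_insert orthogonal_def inner_commute)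
qed

text \<open>Surface integrals become volume integrals by smearing over the normal coordinate with an
  arbitrary weight of total mass one.  This makes the choice of basis in the definition of
  \<open>hyperplane_measure\<close> irrelevant.\<close>

lemma nn_integral_hyperplane_measure:
  fixes a n :: "'a::euclidean_space" and w :: "real \<Rightarrow> ennreal"
  assumes n: "norm n = 1" and c: "c > 0"
    and [measurable]: "h \<in> borel_measurable borel" "w \<in> borel_measurable borel"
    and w: "(\<integral>\<^sup>+t. w t \<partial>lborel) = 1"
  shows "(\<integral>\<^sup>+x. h x \<partial>hyperplane_measure a (c *\<^sub>R n)) =
    (\<integral>\<^sup>+x. h (x - ((x - a) \<bullet> n) *\<^sub>R n) * w ((x - a) \<bullet> n) \<partial>lborel)"
proof -
  interpret product_sigma_finite "\<lambda>_::'a. lborel::real measure" ..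
  define B where "B = (SOME B. orthonormal_basis_of {x. x \<bullet> (c *\<^sub>R n) = 0} B)"
  have "subspace {x. x \<bullet> (c *\<^sub>R n) = 0}" by (auto simp: subspace_def inner_simps)
  from orthonormal_basis_of_exists[OF this]
  have "orthonormal_basis_of {x. x \<bullet> (c *\<^sub>R n) = 0} B" unfolding B_def by (rule someI_ex)
  then have B: "orthonormal_basis_of {x. x \<bullet> n = 0} B" using c by simp
  note I = orthonormal_basis_of_insert_normal[OF B n]
  note D = orthonormal_basis_ofD[OF B]
  have Bn: "b \<bullet> n = 0" if "b \<in> B" for b
    using B that span_base[of b B] by (auto simp: orthonormal_basis_of_def)
  have nn: "n \<bullet> n = 1" using n by (simp add: norm_eq_1)
  have "(\<integral>\<^sup>+x. h (x - ((x - a) \<bullet> n) *\<^sub>R n) * w ((x - a) \<bullet> n) \<partial>lborel)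
      = (\<integral>\<^sup>+x. h (a + x - (x \<bullet> n) *\<^sub>R n) * w (x \<bullet> n) \<partial>lborel)"
    by (subst lborel_distr_plus[of a, symmetric]) (simp add: nn_integral_distr)
  also have "\<dots> = (\<integral>\<^sup>+q. h (a + (\<Sum>b\<in>insert n B. q b *\<^sub>R b) - ((\<Sum>b\<in>insert n B. q b *\<^sub>R b) \<bullet> n) *\<^sub>R n)
      * w ((\<Sum>b\<in>insert n B. q b *\<^sub>R b) \<bullet> n) \<partial>(\<Pi>\<^sub>M b\<in>insert n B. lborel))"
    by (rule nn_integral_lborel_orthonormal_basis[OF I(1)]) measurable
  also have "\<dots> = (\<integral>\<^sup>+q. h (a + (\<Sum>b\<in>B. q b *\<^sub>R b)) * w (q n) \<partial>(\<Pi>\<^sub>M b\<in>insert n B. lborel))"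
  \<comment> \<open>The tangential part is orthogonal to \<open>n\<close>, so the projection cancels
    exactly the \<open>n\<close> term, and the normal coordinate is \<open>q n\<close>.\<close>
  proof (rule nn_integral_cong)
    fix q :: "'a \<Rightarrow> real"
    have "(\<Sum>b\<in>B. q b *\<^sub>R b) \<bullet> n = 0" by (simp add: inner_sum_left Bn)
    then show "h (a + (\<Sum>b\<in>insert n B. q b *\<^sub>R b) - ((\<Sum>b\<in>insert n B. q b *\<^sub>R b) \<bullet> n) *\<^sub>R n)
      * w ((\<Sum>b\<in>insert n B. q b *\<^sub>R b) \<bullet> n) = h (a + (\<Sum>b\<in>B. q b *\<^sub>R b)) * w (q n)"
      using D(1) I(2) by (simp add: inner_add_left nn)
  qed
  also have "\<dots> = (\<integral>\<^sup>+q. \<integral>\<^sup>+t. h (a + (\<Sum>b\<in>B. (q(n := t)) b *\<^sub>R b)) * w ((q(n := t)) n) \<partial>lborel \<partial>(\<Pi>\<^sub>M b\<in>B. lborel))"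
    using D(1) I(2) by (subst product_nn_integral_insert) auto
  also have "\<dots> = (\<integral>\<^sup>+q. h (a + (\<Sum>b\<in>B. q b *\<^sub>R b)) \<partial>(\<Pi>\<^sub>M b\<in>B. lborel))"
  \<comment> \<open>The projected point does not depend on \<open>t\<close>, so the inner integral
    only contributes the mass of \<open>w\<close>, which is 1.\<close>
  proof (rule nn_integral_cong)
    fix q :: "'a \<Rightarrow> real"
    have "(\<Sum>b\<in>B. (q(n := t)) b *\<^sub>R b) = (\<Sum>b\<in>B. q b *\<^sub>R b)" for t
      using I(2) by (intro sum.cong) auto
    then show "(\<integral>\<^sup>+t. h (a + (\<Sum>b\<in>B. (q(n := t)) b *\<^sub>R b)) * w ((q(n := t)) n) \<partial>lborel)
       = h (a + (\<Sum>b\<in>B. q b *\<^sub>R b))"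
      by (simp add: nn_integral_cmult w)
  qed
  also have "\<dots> = (\<integral>\<^sup>+x. h x \<partial>hyperplane_measure a (c *\<^sub>R n))"
    unfolding hyperplane_measure_def Let_def B_def[symmetric] by (subst nn_integral_distr) auto
  finally show ?thesis by simp
qed

section \<open>Gaussian integrals and the Laplace method\<close>

lemma nn_integral_gaussian:
  assumes m: "m > 0"
  shows "(\<integral>\<^sup>+t. ennreal (exp (- (m / 2 * t\<^sup>2))) \<partial>lborel) = ennreal (sqrt (2 * pi / m))"
proof -
  define \<sigma> where "\<sigma> = 1 / sqrt m"
  have \<sigma>: "\<sigma> > 0" "\<sigma>\<^sup>2 = 1 / m" using m by (simp_all add: \<sigma>_def power_divide)
  have "exp (- (m / 2 * t\<^sup>2)) = sqrt (2 * pi / m) * normal_density 0 \<sigma> t" for t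
    using m by (simp add: normal_density_def \<sigma> field_simps)
  moreover have "(\<integral>\<^sup>+t. ennreal (normal_density 0 \<sigma> t) \<partial>lborel) = 1"
    using integral_normal_density[OF \<sigma>(1)] integrable_normal_density[OF \<sigma>(1)]
    by (subst nn_integral_eq_integral) auto
  ultimately show ?thesis
    using m by (simp add: ennreal_mult nn_integral_cmult)
qed

text \<open>On the half-line the integrand has the explicit antiderivative - exp (- m t^2 / 2) / m.
  This moment is the one-sided flux of a single momentum component.\<close>

lemma nn_integral_gaussian_first_moment:
  assumes m: "m > 0"
  shows "(\<integral>\<^sup>+t. ennreal (max t 0 * exp (- (m / 2 * t\<^sup>2))) \<partial>lborel) = ennreal (1 / m)"
proof -
  have "(\<integral>\<^sup>+t. ennreal (max t 0 * exp (- (m / 2 * t\<^sup>2))) \<partial>lborel)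
      = (\<integral>\<^sup>+t. ennreal (t * exp (- (m / 2 * t\<^sup>2))) * indicator {0..} t \<partial>lborel)"
    by (intro nn_integral_cong) (auto simp: indicator_def max_def)
  also have "\<dots> = ennreal (0 - (- exp (- (m / 2 * 0\<^sup>2)) / m))"
  proof (rule nn_integral_FTC_atLeast)
    show "DERIV (\<lambda>t. - exp (- (m / 2 * t\<^sup>2)) / m) x :> x * exp (- (m / 2 * x\<^sup>2))" for x
      using m by (auto intro!: derivative_eq_intros simp: field_simps)
    have "filterlim (\<lambda>t::real. m / 2 * t\<^sup>2) at_top at_top"
      using m by (intro filterlim_tendsto_pos_mult_at_top[OF tendsto_const] filterlim_pow_at_top filterlim_ident) auto
    then have "((\<lambda>t::real. exp (- (m / 2 * t\<^sup>2))) \<longlongrightarrow> 0) at_top"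
      by (intro filterlim_compose[OF exp_at_bot]) (simp add: filterlim_uminus_at_bot)
    from tendsto_divide[OF tendsto_minus[OF this] tendsto_const[of m]]
    show "((\<lambda>t::real. - exp (- (m / 2 * t\<^sup>2)) / m) \<longlongrightarrow> 0) at_top" using m by simp
  qed auto
  finally show ?thesis by simp
qed

lemma nn_integral_gaussian_quadratic:
  fixes B :: "'a::euclidean_space set"
  assumes B: "orthonormal_basis_of UNIV B" and \<mu>: "\<And>b. b \<in> B \<Longrightarrow> \<mu> b > 0"
  shows "(\<integral>\<^sup>+x. ennreal (exp (- ((\<Sum>b\<in>B. \<mu> b * (x \<bullet> b)\<^sup>2) / 2))) \<partial>lborel)
    = ennreal (\<Prod>b\<in>B. sqrt (2 * pi / \<mu> b))"
proof -
  note D = orthonormal_basis_ofD[OF B]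
  have "exp (- ((\<Sum>b\<in>B. \<mu> b * (x \<bullet> b)\<^sup>2) / 2)) = (\<Prod>b\<in>B. exp (- (\<mu> b / 2 * (x \<bullet> b)\<^sup>2)))" for x
    by (simp add: D(1) sum_negf sum_divide_distrib flip: exp_sum)
  then have "(\<integral>\<^sup>+x. ennreal (exp (- ((\<Sum>b\<in>B. \<mu> b * (x \<bullet> b)\<^sup>2) / 2))) \<partial>lborel)
      = (\<integral>\<^sup>+x. (\<Prod>b\<in>B. ennreal (exp (- (\<mu> b / 2 * (x \<bullet> b)\<^sup>2)))) \<partial>lborel)"
    by (simp add: prod_ennreal)
  also have "\<dots> = (\<Prod>b\<in>B. \<integral>\<^sup>+t. ennreal (exp (- (\<mu> b / 2 * t\<^sup>2))) \<partial>lborel)"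
    by (rule nn_integral_lborel_prod_orthonormal_basis[OF B]) measurable
  also have "\<dots> = ennreal (\<Prod>b\<in>B. sqrt (2 * pi / \<mu> b))"
  proof -
    have "(\<Prod>b\<in>B. \<integral>\<^sup>+t. ennreal (exp (- (\<mu> b / 2 * t\<^sup>2))) \<partial>lborel) = (\<Prod>b\<in>B. ennreal (sqrt (2 * pi / \<mu> b)))"
      using \<mu> by (intro prod.cong refl nn_integral_gaussian)
    then show ?thesis using \<mu> by (simp add: prod_ennreal less_imp_le)
  qed
  finally show ?thesis .
qed

lemma has_bochner_integral_gaussian_quadratic:
  fixes B :: "'a::euclidean_space set"
  assumes B: "orthonormal_basis_of UNIV B" and \<mu>: "\<And>b. b \<in> B \<Longrightarrow> \<mu> b > 0"
  shows "has_bochner_integral lborel (\<lambda>x. exp (- ((\<Sum>b\<in>B. \<mu> b * (x \<bullet> b)\<^sup>2) / 2))) (\<Prod>b\<in>B. sqrt (2 * pi / \<mu> b))"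
  using \<mu> by (intro has_bochner_integral_nn_integral nn_integral_gaussian_quadratic[OF B] prod_nonneg)
    (auto simp: less_imp_le)

lemma orthonormal_basis_of_Basis: "orthonormal_basis_of UNIV (Basis :: 'a::euclidean_space set)"
  by (auto simp: orthonormal_basis_of_def pairwise_def orthogonal_def inner_Basis)

text \<open>Domination by a Gaussian centred at \<open>c\<close>. Integrability at every
  \<open>\<beta> > 0\<close> lets an integral be split into near and far parts and rules out the
  default value 0 of a non-integrable integrand.\<close>

lemma integrable_exp_coercive:
  fixes f :: "'a::euclidean_space \<Rightarrow> real"
  assumes [measurable]: "f \<in> borel_measurable borel" and k: "k > 0" and \<beta>: "\<beta> > 0"
    and f: "\<And>x. k * (norm (x - c))\<^sup>2 - d \<le> f x"
  shows "integrable lborel (\<lambda>x. exp (- \<beta> * f x))"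
proof -
  define g :: "'a \<Rightarrow> real" where "g x = exp (- ((\<Sum>b\<in>Basis. (2 * \<beta> * k) * (x \<bullet> b)\<^sup>2) / 2))" for x
  have [measurable]: "g \<in> borel_measurable borel" unfolding g_def[abs_def] by measurable
  have "integrable lborel g"
    unfolding g_def[abs_def] using k \<beta>
    by (intro integrable.intros[OF has_bochner_integral_gaussian_quadratic[OF orthonormal_basis_of_Basis,
          where \<mu> = "\<lambda>_. 2 * \<beta> * k"]]) auto
  then have "integrable (distr lborel borel ((+) (- c))) g" by (simp add: lborel_distr_plus)
  then have "integrable lborel (\<lambda>x. g (x - c))"
    by (subst (asm) integrable_distr_eq) (auto simp: g_def)
  then have "integrable lborel (\<lambda>x. exp (\<beta> * d) * g (x - c))" by simp
  then show ?thesis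
  proof (rule Bochner_Integration.integrable_bound)
    have "exp (- \<beta> * f x) \<le> exp (\<beta> * d) * g (x - c)" for x
    proof -
      have "(norm (x - c))\<^sup>2 = (\<Sum>b\<in>Basis. ((x - c) \<bullet> b)\<^sup>2)"
        unfolding power2_norm_eq_inner by (subst euclidean_inner) (simp add: power2_eq_square)
      then have "exp (\<beta> * d) * g (x - c) = exp (- \<beta> * (k * (norm (x - c))\<^sup>2 - d))"
        by (simp add: g_def exp_add[symmetric] algebra_simps sum_distrib_left[symmetric])
      then show ?thesis using f[of x] \<beta> by simp
    qed
    then show "AE x in lborel. norm (exp (- \<beta> * f x)) \<le> norm (exp (\<beta> * d) * g (x - c))"
      by (simp add: g_def)
  qed simp
qed

text \<open>The second-order expansion with Peano remainder at a critical point, hence without a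
  linear term. Taken as the interface of the Laplace lemmas, it passes directly to the smeared
  function on the hyperplane, with no second derivatives of compositions to compute.\<close>

definition quadratic_expansion :: "('a::real_normed_vector \<Rightarrow> real) \<Rightarrow> 'a \<Rightarrow> ('a \<Rightarrow> real) \<Rightarrow> bool" where
  "quadratic_expansion f x q \<longleftrightarrow>
    (\<forall>\<eta>>0. \<forall>\<^sub>F h in nhds 0. \<bar>f (x + h) - f x - q h / 2\<bar> \<le> \<eta> * (norm h)\<^sup>2)"

lemma quadratic_expansion_lower_bound:
  fixes B :: "'a::euclidean_space set"
  assumes B: "orthonormal_basis_of UNIV B" and \<mu>: "\<And>b. b \<in> B \<Longrightarrow> \<mu> b > 0"
    and f: "quadratic_expansion f x (\<lambda>h. \<Sum>b\<in>B. \<mu> b * (h \<bullet> b)\<^sup>2)"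
  shows "\<forall>\<^sub>F h in nhds 0. f x + (\<Sum>b\<in>B. \<mu> b * (h \<bullet> b)\<^sup>2) / 4 \<le> f (x + h)"
proof -
  note D = orthonormal_basis_ofD[OF B]
  have "B \<noteq> {}" using B by (auto simp: orthonormal_basis_of_def)
  \<comment> \<open>The smallest eigenvalue: a remainder of at most m/4 * |h|^2 uses up at most half
    of the main term q/2, which leaves q/4.\<close>
  define m where "m = Min (\<mu> ` B)"
  have m: "m > 0" "\<And>b. b \<in> B \<Longrightarrow> m \<le> \<mu> b" using D(1) \<open>B \<noteq> {}\<close> \<mu> by (auto simp: m_def)
  have le: "m * (norm h)\<^sup>2 \<le> (\<Sum>b\<in>B. \<mu> b * (h \<bullet> b)\<^sup>2)" for h
  proof -
    have "(norm h)\<^sup>2 = (\<Sum>b\<in>B. (h \<bullet> b)\<^sup>2)"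
      unfolding power2_norm_eq_inner using orthonormal_basis_of_inner[OF B, of h h]
      by (simp add: power2_eq_square)
    then show ?thesis using m by (auto simp: sum_distrib_left intro!: sum_mono mult_right_mono)
  qed
  have "\<forall>\<^sub>F h in nhds 0. \<bar>f (x + h) - f x - (\<Sum>b\<in>B. \<mu> b * (h \<bullet> b)\<^sup>2) / 2\<bar> \<le> m / 4 * (norm h)\<^sup>2"
    using f m(1) unfolding quadratic_expansion_def by (elim allE[of _ "m / 4"]) simp
  then show ?thesis
  proof eventually_elim
    case (elim h)
    define R where "R = f (x + h) - f x - (\<Sum>b\<in>B. \<mu> b * (h \<bullet> b)\<^sup>2) / 2"
    have "\<bar>R\<bar> \<le> (\<Sum>b\<in>B. \<mu> b * (h \<bullet> b)\<^sup>2) / 4" using elim le[of h] by (simp add: R_def)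
    then have "- R \<le> (\<Sum>b\<in>B. \<mu> b * (h \<bullet> b)\<^sup>2) / 4" by linarith
    then show ?case unfolding R_def by linarith
  qed
qed

text \<open>At h = y / sqrt beta the remainder is at most eta |y|^2 / beta, and the prefactor beta
  cancels the 1 / beta.\<close>

lemma quadratic_expansion_rescaled_limit:
  fixes f :: "'a::euclidean_space \<Rightarrow> real"
  assumes f: "quadratic_expansion f x q" and q: "\<And>c h. q (c *\<^sub>R h) = c\<^sup>2 * q h"
  shows "((\<lambda>\<beta>. \<beta> * (f (x + (1 / sqrt \<beta>) *\<^sub>R y) - f x)) \<longlongrightarrow> q y / 2) at_top"
proof (rule tendstoI)
  fix e :: real assume e: "e > 0"
  \<comment> \<open>The summand 1 keeps the denominator positive at y = 0; the factor 2 makes the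
    final inequality strict.\<close>
  define \<eta> where "\<eta> = e / (2 * ((norm y)\<^sup>2 + 1))"
  have pos: "(norm y)\<^sup>2 + 1 > 0" by (simp add: add_nonneg_pos)
  then have "\<eta> > 0" using e by (simp add: \<eta>_def)
  have "((\<lambda>\<beta>. (1 / sqrt \<beta>) *\<^sub>R y) \<longlongrightarrow> 0 *\<^sub>R y) at_top"
    by (intro tendsto_scaleR tendsto_const tendsto_divide_0[OF tendsto_const] filterlim_at_top_imp_at_infinity sqrt_at_top)
  then have lim: "filterlim (\<lambda>\<beta>. (1 / sqrt \<beta>) *\<^sub>R y) (nhds 0) at_top" by simp
  have "\<forall>\<^sub>F h in nhds 0. \<bar>f (x + h) - f x - q h / 2\<bar> \<le> \<eta> * (norm h)\<^sup>2"
    using f \<open>\<eta> > 0\<close> by (simp add: quadratic_expansion_def)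
  from eventually_compose_filterlim[OF this lim] eventually_gt_at_top[of "0::real"]
  show "\<forall>\<^sub>F \<beta> in at_top. dist (\<beta> * (f (x + (1 / sqrt \<beta>) *\<^sub>R y) - f x)) (q y / 2) < e"
  proof eventually_elim
    case (elim \<beta>)
    define r where "r = f (x + (1 / sqrt \<beta>) *\<^sub>R y) - f x"
    have "\<bar>r - (1 / \<beta>) * (q y / 2)\<bar> \<le> \<eta> * ((1 / \<beta>) * (norm y)\<^sup>2)"
      using elim by (simp add: q power_divide r_def power_mult_distrib)
    then have "\<beta> * \<bar>r - (1 / \<beta>) * (q y / 2)\<bar> \<le> \<beta> * (\<eta> * ((1 / \<beta>) * (norm y)\<^sup>2))"
      using elim by (intro mult_left_mono) auto
    also have "\<dots> = \<eta> * (norm y)\<^sup>2" using elim by simp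
    also have "\<beta> * \<bar>r - (1 / \<beta>) * (q y / 2)\<bar> = \<bar>\<beta> * (r - (1 / \<beta>) * (q y / 2))\<bar>"
      using elim by (simp add: abs_mult)
    also have "\<beta> * (r - (1 / \<beta>) * (q y / 2)) = \<beta> * r - q y / 2"
      using elim by (simp add: right_diff_distrib)
    finally have "\<bar>\<beta> * r - q y / 2\<bar> \<le> \<eta> * (norm y)\<^sup>2" .
    also have "\<dots> \<le> \<eta> * ((norm y)\<^sup>2 + 1)" using \<open>\<eta> > 0\<close> by simp
    also have "\<dots> = e / 2" using pos unfolding \<eta>_def by (simp only: times_divide_eq_left) (simp add: field_simps)
    finally show ?case using e by (simp add: dist_real_def r_def)
  qed
qed

text \<open>\<open>lower\<close> is required on all of \<open>A\<close> because it yields, after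
  rescaling, a dominating function independent of \<open>\<beta>\<close>. The set \<open>A\<close>
  may be unbounded, which the hyperplane case exploits.\<close>

lemma laplace_localized:
  fixes B :: "'a::euclidean_space set"
  assumes B: "orthonormal_basis_of UNIV B" and \<mu>: "\<And>b. b \<in> B \<Longrightarrow> \<mu> b > 0"
    and f [measurable]: "f \<in> borel_measurable borel"
    and expansion: "quadratic_expansion f x (\<lambda>h. \<Sum>b\<in>B. \<mu> b * (h \<bullet> b)\<^sup>2)"
    and A [measurable]: "A \<in> sets borel" and x: "x \<in> interior A"
    and lower: "\<And>h. x + h \<in> A \<Longrightarrow> f x + (\<Sum>b\<in>B. \<mu> b * (h \<bullet> b)\<^sup>2) / 4 \<le> f (x + h)"
  shows "((\<lambda>\<beta>. sqrt \<beta> ^ DIM('a) * exp (\<beta> * f x) * (LINT y:A|lborel. exp (- \<beta> * f y)))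
    \<longlongrightarrow> (\<Prod>b\<in>B. sqrt (2 * pi / \<mu> b))) at_top"
proof -
  define q where "q h = (\<Sum>b\<in>B. \<mu> b * (h \<bullet> b)\<^sup>2)" for h
  have q_scale: "q (c *\<^sub>R h) = c\<^sup>2 * q h" for c h
    by (simp add: q_def power_mult_distrib sum_distrib_left mult_ac)
  have [measurable]: "q \<in> borel_measurable borel" unfolding q_def[abs_def] by measurable
  \<comment> \<open>The integrand in rescaled coordinates, with its value at the critical point
    divided out.\<close>
  define s where "s \<beta> y = indicat_real A (x + (1 / sqrt \<beta>) *\<^sub>R y) * exp (- (\<beta> * (f (x + (1 / sqrt \<beta>) *\<^sub>R y) - f x)))" for \<beta> y
  have int: "has_bochner_integral lborel (\<lambda>y. exp (- (q y / 2))) (\<Prod>b\<in>B. sqrt (2 * pi / \<mu> b))"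
    unfolding q_def by (rule has_bochner_integral_gaussian_quadratic[OF B \<mu>])
  \<comment> \<open>The dominating function: exponent q/4 is a Gaussian with eigenvalues
    \<open>\<mu> b / 2\<close>.\<close>
  have int4: "integrable lborel (\<lambda>y. exp (- (q y / 4)))"
  proof -
    have q4: "q y / 4 = (\<Sum>b\<in>B. \<mu> b / 2 * (y \<bullet> b)\<^sup>2) / 2" for y
      by (simp add: q_def sum_divide_distrib)
    then show ?thesis
      unfolding q4 using \<mu>
      by (intro integrable.intros[OF has_bochner_integral_gaussian_quadratic[OF B, where \<mu> = "\<lambda>b. \<mu> b / 2"]]) auto
  qed
  have lim: "((\<lambda>\<beta>. integral\<^sup>L lborel (s \<beta>)) \<longlongrightarrow> (\<integral>y. exp (- (q y / 2)) \<partial>lborel)) at_top"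
  proof (rule integral_dominated_convergence_at_top[OF _ _ int4])
    show "AE y in lborel. ((\<lambda>\<beta>. s \<beta> y) \<longlongrightarrow> exp (- (q y / 2))) at_top"
    proof (rule AE_I2)
      fix y :: 'a
      have "((\<lambda>\<beta>. exp (- (\<beta> * (f (x + (1 / sqrt \<beta>) *\<^sub>R y) - f x)))) \<longlongrightarrow> exp (- (q y / 2))) at_top"
        using expansion q_scale unfolding q_def[symmetric]
        by (intro tendsto_exp tendsto_minus quadratic_expansion_rescaled_limit) auto
      moreover have "\<forall>\<^sub>F \<beta> in at_top. exp (- (\<beta> * (f (x + (1 / sqrt \<beta>) *\<^sub>R y) - f x))) = s \<beta> y"
      proof -
        \<comment> \<open>The rescaled points tend to the interior point \<open>x\<close>, so the
          indicator of \<open>A\<close> in \<open>s \<beta> y\<close> is eventually 1.\<close>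
        have "((\<lambda>\<beta>. x + (1 / sqrt \<beta>) *\<^sub>R y) \<longlongrightarrow> x + 0 *\<^sub>R y) at_top"
          by (intro tendsto_add tendsto_scaleR tendsto_const tendsto_divide_0[OF tendsto_const] filterlim_at_top_imp_at_infinity sqrt_at_top)
        then have "\<forall>\<^sub>F \<beta> in at_top. x + (1 / sqrt \<beta>) *\<^sub>R y \<in> interior A"
          using x by (intro topological_tendstoD) auto
        then show ?thesis
        proof eventually_elim
          case (elim \<beta>)
          then have "x + (1 / sqrt \<beta>) *\<^sub>R y \<in> A" using interior_subset by blast
          then show ?case by (simp add: s_def)
        qed
      qed
      ultimately show "((\<lambda>\<beta>. s \<beta> y) \<longlongrightarrow> exp (- (q y / 2))) at_top"
        by (rule Lim_transform_eventually)
    qed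
    show "\<forall>\<^sub>F \<beta> in at_top. AE y in lborel. norm (s \<beta> y) \<le> exp (- (q y / 4))"
      using eventually_gt_at_top[of "0::real"]
    proof eventually_elim
      case (elim \<beta>)
      have "norm (s \<beta> y) \<le> exp (- (q y / 4))" for y
      proof (cases "x + (1 / sqrt \<beta>) *\<^sub>R y \<in> A")
        case True
        from lower[OF this] have "\<beta> * (q ((1 / sqrt \<beta>) *\<^sub>R y) / 4) \<le> \<beta> * (f (x + (1 / sqrt \<beta>) *\<^sub>R y) - f x)"
          using elim unfolding q_def[symmetric] by (intro mult_left_mono) auto
        then have "q y / 4 \<le> \<beta> * (f (x + (1 / sqrt \<beta>) *\<^sub>R y) - f x)"
          using elim unfolding q_scale by (simp add: power_divide)
        then show ?thesis by (simp add: s_def abs_mult indicator_def)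
      qed (simp add: s_def)
      then show ?case by simp
    qed
  qed (simp_all add: s_def[abs_def])
  have "\<forall>\<^sub>F \<beta> in at_top. integral\<^sup>L lborel (s \<beta>)
     = sqrt \<beta> ^ DIM('a) * exp (\<beta> * f x) * (LINT y:A|lborel. exp (- \<beta> * f y))"
    using eventually_gt_at_top[of "0::real"]
  proof eventually_elim
    case (elim \<beta>)
    define c where "c = 1 / sqrt \<beta>"
    have c: "c > 0" "c \<noteq> 0" using elim by (auto simp: c_def)
    have "(LINT y:A|lborel. exp (- \<beta> * f y))
      = (\<integral>y. indicator A y *\<^sub>R exp (- \<beta> * f y) \<partial>(density (distr lborel borel (\<lambda>y. x + c *\<^sub>R y)) (\<lambda>_. \<bar>c\<bar> ^ DIM('a))))"
      unfolding set_lebesgue_integral_def using lborel_affine[OF c(2), of x] by simp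
    also have "\<dots> = (\<integral>y. c ^ DIM('a) * (indicator A (x + c *\<^sub>R y) * exp (- \<beta> * f (x + c *\<^sub>R y))) \<partial>lborel)"
      using c by (subst integral_density) (auto simp: integral_distr)
    also have "\<dots> = c ^ DIM('a) * (\<integral>y. indicator A (x + c *\<^sub>R y) * exp (- \<beta> * f (x + c *\<^sub>R y)) \<partial>lborel)"
      by simp
    also have "(\<lambda>y. indicator A (x + c *\<^sub>R y) * exp (- \<beta> * f (x + c *\<^sub>R y))) = (\<lambda>y. exp (- (\<beta> * f x)) * s \<beta> y)"
      by (auto simp: s_def c_def fun_eq_iff exp_add[symmetric] right_diff_distrib exp_diff exp_minus field_simps)
    finally have *: "(LINT y:A|lborel. exp (- \<beta> * f y)) = c ^ DIM('a) * (exp (- (\<beta> * f x)) * integral\<^sup>L lborel (s \<beta>))"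
      by simp
    have "sqrt \<beta> ^ DIM('a) * c ^ DIM('a) = 1" using elim by (simp add: c_def power_mult_distrib[symmetric])
    moreover have "exp (\<beta> * f x) * exp (- (\<beta> * f x)) = 1" by (simp add: exp_minus_inverse)
    ultimately show ?case unfolding * by (metis (no_types, opaque_lifting) mult.assoc mult.left_commute mult.right_neutral)
  qed
  from Lim_transform_eventually[OF lim this] show ?thesis
    using int by (simp add: has_bochner_integral_iff)
qed

text \<open>With L, J, I the integrals over \<open>A\<close>, \<open>D - A\<close> and
  \<open>D\<close>, the identity I = L / (1 - J / I) transfers the asymptotics of L to I once the
  tail fraction J / I tends to 0. The concentration hypothesis bounds precisely this
  fraction.\<close>

lemma laplace_concentrated:
  fixes B :: "'a::euclidean_space set"
  assumes B: "orthonormal_basis_of UNIV B" and \<mu>: "\<And>b. b \<in> B \<Longrightarrow> \<mu> b > 0"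
    and f [measurable]: "f \<in> borel_measurable borel"
    and expansion: "quadratic_expansion f x (\<lambda>h. \<Sum>b\<in>B. \<mu> b * (h \<bullet> b)\<^sup>2)"
    and A [measurable]: "A \<in> sets borel" and x: "x \<in> interior A"
    and lower: "\<And>h. x + h \<in> A \<Longrightarrow> f x + (\<Sum>b\<in>B. \<mu> b * (h \<bullet> b)\<^sup>2) / 4 \<le> f (x + h)"
    and D [measurable]: "D \<in> sets borel" and AD: "A \<subseteq> D"
    and int: "\<And>\<beta>. \<beta> > 0 \<Longrightarrow> integrable lborel (\<lambda>y. exp (- \<beta> * f y))"
    and c: "c > 0" and tail: "\<And>\<beta>. \<beta> > \<beta>0 \<Longrightarrow>
       (LINT y:D - A|lborel. exp (- \<beta> * f y)) / (LINT y:D|lborel. exp (- \<beta> * f y)) \<le> K * exp (- c * \<beta>)"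
  shows "((\<lambda>\<beta>. sqrt \<beta> ^ DIM('a) * exp (\<beta> * f x) * (LINT y:D|lborel. exp (- \<beta> * f y)))
    \<longlongrightarrow> (\<Prod>b\<in>B. sqrt (2 * pi / \<mu> b))) at_top"
proof -
  define L where "L \<beta> = (LINT y:A|lborel. exp (- \<beta> * f y))" for \<beta>
  define I where "I \<beta> = (LINT y:D|lborel. exp (- \<beta> * f y))" for \<beta>
  define J where "J \<beta> = (LINT y:D - A|lborel. exp (- \<beta> * f y))" for \<beta>
  define G where "G = (\<Prod>b\<in>B. sqrt (2 * pi / \<mu> b))"
  have "G > 0" using \<mu> by (auto simp: G_def intro!: prod_pos)
  have lim: "((\<lambda>\<beta>. sqrt \<beta> ^ DIM('a) * exp (\<beta> * f x) * L \<beta>) \<longlongrightarrow> G) at_top"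
    unfolding L_def G_def by (rule laplace_localized) fact+
  have sum: "I \<beta> = J \<beta> + L \<beta>" if "\<beta> > 0" for \<beta>
  proof -
    have si: "set_integrable lborel E (\<lambda>y. exp (- \<beta> * f y))" if "E \<in> sets borel" for E
      unfolding set_integrable_def using int[OF \<open>\<beta> > 0\<close>] that by (intro integrable_mult_indicator) auto
    have "D = (D - A) \<union> A" using AD by auto
    then have "I \<beta> = (LINT y:(D - A) \<union> A|lborel. exp (- \<beta> * f y))" by (simp add: I_def)
    also have "\<dots> = J \<beta> + L \<beta>"
      unfolding J_def L_def by (intro set_integral_Un si) auto
    finally show ?thesis .
  qed
  have J0: "J \<beta> \<ge> 0" for \<beta> unfolding J_def set_lebesgue_integral_def by (intro integral_nonneg_AE) simp
  have I0: "I \<beta> \<ge> 0" for \<beta> unfolding I_def set_lebesgue_integral_def by (intro integral_nonneg_AE) simp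
  have "((\<lambda>\<beta>. J \<beta> / I \<beta>) \<longlongrightarrow> 0) at_top"
  proof (rule tendsto_sandwich[OF _ _ tendsto_const])
    show "\<forall>\<^sub>F \<beta> in at_top. 0 \<le> J \<beta> / I \<beta>" using J0 I0 by simp
    show "\<forall>\<^sub>F \<beta> in at_top. J \<beta> / I \<beta> \<le> K * exp (- c * \<beta>)"
      using eventually_gt_at_top[of \<beta>0] by eventually_elim (use tail in \<open>simp add: J_def I_def\<close>)
    have "filterlim (\<lambda>\<beta>. - c * \<beta>) at_bot at_top"
      using c by (intro filterlim_tendsto_neg_mult_at_bot[OF tendsto_const] filterlim_ident) auto
    then have "((\<lambda>\<beta>. exp (- c * \<beta>)) \<longlongrightarrow> 0) at_top" by (rule filterlim_compose[OF exp_at_bot])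
    from tendsto_mult[OF tendsto_const[of K] this]
    show "((\<lambda>\<beta>. K * exp (- c * \<beta>)) \<longlongrightarrow> 0) at_top" by simp
  qed
  then have "((\<lambda>\<beta>. 1 - J \<beta> / I \<beta>) \<longlongrightarrow> 1 - 0) at_top" by (intro tendsto_diff tendsto_const)
  from tendsto_divide[OF lim this]
  have "((\<lambda>\<beta>. sqrt \<beta> ^ DIM('a) * exp (\<beta> * f x) * L \<beta> / (1 - J \<beta> / I \<beta>)) \<longlongrightarrow> G) at_top" by simp
  moreover have "\<forall>\<^sub>F \<beta> in at_top. sqrt \<beta> ^ DIM('a) * exp (\<beta> * f x) * L \<beta> / (1 - J \<beta> / I \<beta>)
      = sqrt \<beta> ^ DIM('a) * exp (\<beta> * f x) * I \<beta>"
    \<comment> \<open>Positivity of the limit \<open>G\<close> forces L > 0, hence I > 0,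
      eventually; only then is J / I a genuine quotient and not the default value 0.\<close>
    using eventually_gt_at_top[of "0::real"] order_tendstoD(1)[OF lim \<open>G > 0\<close>]
  proof eventually_elim
    case (elim \<beta>)
    have "0 < sqrt \<beta> ^ DIM('a) * exp (\<beta> * f x)" using elim by simp
    with elim(2) have "L \<beta> > 0" by (simp only: zero_less_mult_pos)
    then have "I \<beta> > 0" using sum[OF elim(1)] J0[of \<beta>] by simp
    then have "1 - J \<beta> / I \<beta> = L \<beta> / I \<beta>" using sum[OF elim(1)] by (simp add: field_simps)
    then show ?case using \<open>L \<beta> > 0\<close> \<open>I \<beta> > 0\<close> by simp
  qed
  ultimately show ?thesis unfolding I_def G_def by (rule Lim_transform_eventually)
qed

section \<open>The energy near critical points\<close>

lemma smooth_funD: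
  assumes "smooth_fun V"
  shows "(V has_real_derivative deriv V x) (at x)"
    "(deriv V has_real_derivative deriv (deriv V) x) (at x)"
proof -
  have "V differentiable (at x)" "deriv V differentiable (at x)"
    using assms[unfolded smooth_fun_def, rule_format, of 0 x] assms[unfolded smooth_fun_def, rule_format, of 1 x]
    by simp_all
  then show "(V has_real_derivative deriv V x) (at x)"
    "(deriv V has_real_derivative deriv (deriv V) x) (at x)"
    by (auto simp: DERIV_deriv_iff_real_differentiable)
qed

text \<open>The remainder vanishes at t = 0, and its derivative V' (x + s) - V' x - d s is at most
  eta |s| near 0, because \<open>V'\<close> is differentiable at \<open>x\<close>. The mean value
  inequality on the interval of radius |t| then gives eta t^2.\<close>

lemma second_order_taylor:
  fixes V V' :: "real \<Rightarrow> real"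
  assumes V: "\<And>y. (V has_real_derivative V' y) (at y)" and V': "(V' has_real_derivative d) (at x)"
    and \<eta>: "\<eta> > 0"
  shows "\<forall>\<^sub>F t in nhds 0. \<bar>V (x + t) - V x - V' x * t - d / 2 * t\<^sup>2\<bar> \<le> \<eta> * t\<^sup>2"
proof -
  have "(V' has_derivative (*) d) (at x)" using V' by (simp add: has_field_derivative_def)
  from has_derivative_at_alt[THEN iffD1, OF this] \<eta>
  obtain e where e: "e > 0" "\<And>y. norm (y - x) < e \<Longrightarrow> norm (V' y - V' x - d * (y - x)) \<le> \<eta> * norm (y - x)"
    by metis
  have "\<bar>V (x + t) - V x - V' x * t - d / 2 * t\<^sup>2\<bar> \<le> \<eta> * t\<^sup>2" if t: "\<bar>t\<bar> < e" for t
  proof -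
    define g where "g s = V (x + s) - V x - V' x * s - d / 2 * s\<^sup>2" for s
    have "norm (g t - g 0) \<le> \<eta> * \<bar>t\<bar> * norm (t - 0)"
    proof (rule field_differentiable_bound[of "cball 0 \<bar>t\<bar>" g "\<lambda>s. V' (x + s) - V' x - d * s"])
      show "(g has_real_derivative V' (x + s) - V' x - d * s) (at s within cball 0 \<bar>t\<bar>)" for s
      proof -
        have "((\<lambda>s. V (x + s)) has_real_derivative V' (x + s)) (at s within cball 0 \<bar>t\<bar>)"
          by (rule DERIV_chain'[where g = V, OF _ V, THEN DERIV_cong]) (auto intro!: derivative_eq_intros)
        then show ?thesis unfolding g_def[abs_def] by (auto intro!: derivative_eq_intros)
      qed
      show "norm (V' (x + s) - V' x - d * s) \<le> \<eta> * \<bar>t\<bar>" if "s \<in> cball 0 \<bar>t\<bar>" for s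
      proof -
        have "norm (V' (x + s) - V' x - d * s) \<le> \<eta> * \<bar>s\<bar>" using e(2)[of "x + s"] that t by auto
        also have "\<dots> \<le> \<eta> * \<bar>t\<bar>" using that \<eta> by (intro mult_left_mono) auto
        finally show ?thesis .
      qed
    qed auto
    then show ?thesis by (simp add: g_def power2_eq_square)
  qed
  then show ?thesis
    using e(1) by (auto simp: eventually_nhds_metric dist_real_def)
qed

lemma quadratic_lower_bound:
  fixes V :: "real \<Rightarrow> real"
  assumes bdd: "bdd_below (range V)" and growth: "\<exists>C>0. \<forall>\<^sub>F x in at_infinity. V x \<ge> C * x\<^sup>2"
  obtains C d where "C > 0" "\<And>x. C * x\<^sup>2 - d \<le> V x"
proof -
  obtain C b where C: "C > 0" "\<And>x. norm x \<ge> b \<Longrightarrow> V x \<ge> C * x\<^sup>2"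
    using growth by (auto simp: eventually_at_infinity)
  obtain m where m: "\<And>x. m \<le> V x" using bdd by (auto simp: bdd_below_def)
  \<comment> \<open>One constant for both cases: outside radius \<open>b\<close> the growth
    hypothesis needs only a nonnegative constant; inside, C b^2 pays for C x^2 and |m| for the lower
    bound of \<open>V\<close>.\<close>
  have "C * x\<^sup>2 - (C * b\<^sup>2 + \<bar>m\<bar>) \<le> V x" for x
  proof (cases "norm x \<ge> b")
    case True
    have "0 \<le> C * b\<^sup>2 + \<bar>m\<bar>" using C(1) by simp
    then show ?thesis using C(2)[OF True] by linarith
  next
    case False
    then have "\<bar>x\<bar> \<le> b" by simp
    then have "x\<^sup>2 \<le> b\<^sup>2" by (metis abs_ge_zero power2_abs power_mono)
    then have "C * x\<^sup>2 \<le> C * b\<^sup>2" using C(1) by simp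
    then show ?thesis using m[of x] by linarith
  qed
  then show thesis using C(1) that by blast
qed

section \<open>The elastic form, the Hessian form and its eigenvectors\<close>

lemma summation_by_parts:
  fixes a b :: "nat \<Rightarrow> real"
  shows "(\<Sum>j = 0..n. (a (j + 1) - a j) * (b (j + 1) - b j)) =
    a (n + 1) * (b (n + 1) - b n) - a 0 * (b 1 - b 0)
    - (\<Sum>j = 1..n. a j * (b (j - 1) - 2 * b j + b (j + 1)))"
  by (induction n) (simp_all add: algebra_simps)

lemma norm_vec_power2: "(norm (h :: real ^ 'n::finite))\<^sup>2 = (\<Sum>i\<in>UNIV. (h $ i)\<^sup>2)"
  unfolding power2_norm_eq_inner inner_vec_def by (simp add: power2_eq_square)

locale lattice_chain =
  fixes bc :: boundary and site :: "nat \<Rightarrow> 'n::finite" and \<delta> :: real and V :: "real \<Rightarrow> real"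
  assumes site: "bij_betw site {1..CARD('n)} UNIV"
    and V_smooth: "smooth_fun V"
begin

text \<open>The discrete Dirichlet form, over all N + 1 bonds including those to the two boundary
  values: the bilinear form of minus the discrete Laplacian.\<close>

definition stiffness :: "real ^ 'n \<Rightarrow> real ^ 'n \<Rightarrow> real" where
  "stiffness h k = (\<Sum>j = 0..CARD('n). (extend bc site h (j + 1) - extend bc site h j)
     * (extend bc site k (j + 1) - extend bc site k j))"

text \<open>The second derivative of the energy as an explicit bilinear form. It is tied to
  \<open>U\<close> by the quadratic expansion at critical points rather than by iterated Frechet
  derivatives, and to the eigenvalue problem by summation by parts.\<close>

definition hessian_form :: "real ^ 'n \<Rightarrow> real ^ 'n \<Rightarrow> real ^ 'n \<Rightarrow> real" where
  "hessian_form u h k = 1 / real CARD('n) * (\<Sum>i\<in>UNIV. deriv (deriv V) (u $ i) * h $ i * k $ i)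
     + real CARD('n) * \<delta>\<^sup>2 * stiffness h k"

abbreviation U :: "real ^ 'n \<Rightarrow> real" where "U \<equiv> potential_energy bc site \<delta> V"

lemma extend_add: "extend bc site (h + k) j = extend bc site h j + extend bc site k j"
  and extend_scaleR: "extend bc site (c *\<^sub>R h) j = c * extend bc site h j"
  by (auto simp: extend_def split: boundary.splits)

lemma sum_site: "(\<Sum>j = 1..CARD('n). g (site j)) = (\<Sum>i\<in>UNIV. g i)"
  by (rule sum.reindex_bij_betw[OF site])

lemma stiffness_commute: "stiffness h k = stiffness k h"
  by (simp add: stiffness_def mult.commute)

lemma bounded_linear_stiffness: "bounded_linear (stiffness h)"
proof -
  have "linear (stiffness h)"
    by (intro linearI) (auto simp: stiffness_def extend_add extend_scaleR algebra_simps
        sum.distrib sum_distrib_left sum_subtractf)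
  then show ?thesis by (simp add: linear_conv_bounded_linear)
qed

lemma stiffness_add_right: "stiffness h (k + l) = stiffness h k + stiffness h l"
  and stiffness_scaleR_right: "stiffness h (c *\<^sub>R k) = c * stiffness h k"
  using bounded_linear.linear[OF bounded_linear_stiffness] by (auto simp: linear_add linear_scale)

lemma stiffness_add_left: "stiffness (k + l) h = stiffness k h + stiffness l h"
  by (metis stiffness_commute stiffness_add_right)

lemma stiffness_nonneg: "stiffness h h \<ge> 0"
  unfolding stiffness_def by (intro sum_nonneg) (simp flip: power2_eq_square)

lemma potential_energy_eq:
  "U u = 1 / real CARD('n) * (\<Sum>i\<in>UNIV. V (u $ i)) + real CARD('n) * \<delta>\<^sup>2 * stiffness u u / 2"
  unfolding potential_energy_def stiffness_def sum_site[of "\<lambda>i. V (u $ i)"]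
  by (simp add: sum_distrib_left sum_distrib_right sum_divide_distrib power2_eq_square mult_ac)

lemma stiffness_eq_laplacian:
  "stiffness h k = - (\<Sum>j = 1..CARD('n). h $ site j *
     (extend bc site k (j - 1) - 2 * extend bc site k j + extend bc site k (j + 1)))"
proof -
  \<comment> \<open>Boundary terms: under Dirichlet conditions \<open>h\<close> vanishes at 0 and N
    + 1, under Neumann conditions the boundary differences of \<open>k\<close> vanish.\<close>
  have "extend bc site h (CARD('n) + 1) * (extend bc site k (CARD('n) + 1) - extend bc site k CARD('n)) = 0"
    "extend bc site h 0 * (extend bc site k 1 - extend bc site k 0) = 0"
    by (auto simp: extend_def Suc_le_eq split: boundary.splits)
  moreover have "(\<Sum>j = 1..CARD('n). extend bc site h j *
     (extend bc site k (j - 1) - 2 * extend bc site k j + extend bc site k (j + 1)))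
    = (\<Sum>j = 1..CARD('n). h $ site j *
     (extend bc site k (j - 1) - 2 * extend bc site k j + extend bc site k (j + 1)))"
    by (intro sum.cong) (auto simp: extend_def)
  ultimately show ?thesis unfolding stiffness_def summation_by_parts by (simp only:)
qed

lemma hessian_form_commute: "hessian_form u h k = hessian_form u k h"
  by (simp add: hessian_form_def stiffness_commute[of h] mult_ac)

lemma linear_hessian_form: "linear (hessian_form u h)"
  by (intro linearI) (auto simp: hessian_form_def stiffness_add_right stiffness_scaleR_right
      algebra_simps sum.distrib sum_distrib_left add_divide_distrib)

text \<open>Summation by parts moves both differences onto \<open>\<phi>\<close>, where the
  eigenvalue equation applies at each site.\<close>

lemma hessian_form_eigenvector:
  assumes "eigenpair bc site \<delta> V u l \<phi>"
  shows "hessian_form u h \<phi> = l / real CARD('n) * (h \<bullet> \<phi>)"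
proof -
  define L where "L j = extend bc site \<phi> (j - 1) - 2 * extend bc site \<phi> j + extend bc site \<phi> (j + 1)" for j
  have N: "real CARD('n) > 0" by simp
  have "real CARD('n) * hessian_form u h \<phi>
     = (\<Sum>j = 1..CARD('n). deriv (deriv V) (u $ site j) * h $ site j * \<phi> $ site j)
       - (real CARD('n))\<^sup>2 * \<delta>\<^sup>2 * (\<Sum>j = 1..CARD('n). h $ site j * L j)"
    unfolding hessian_form_def stiffness_eq_laplacian L_def sum_site[of "\<lambda>i. deriv (deriv V) (u $ i) * h $ i * \<phi> $ i"]
    using N by (simp add: right_diff_distrib power2_eq_square)
  also have "\<dots> = (\<Sum>j = 1..CARD('n). h $ site j * (- (\<delta>\<^sup>2) * (real CARD('n))\<^sup>2 * L j + deriv (deriv V) (u $ site j) * \<phi> $ site j))"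
    unfolding sum_distrib_left sum_subtractf[symmetric] by (intro sum.cong) (auto simp: algebra_simps)
  also have "\<dots> = (\<Sum>j = 1..CARD('n). h $ site j * (l * \<phi> $ site j))"
    using assms by (intro sum.cong) (auto simp: eigenpair_def L_def)
  also have "\<dots> = l * (h \<bullet> \<phi>)"
    unfolding sum_site[of "\<lambda>i. h $ i * (l * \<phi> $ i)"] inner_vec_def by (simp add: sum_distrib_left mult_ac)
  finally show ?thesis using N by (simp add: field_simps)
qed

text \<open>The form is symmetric and the eigenvalues are distinct, so the eigenvectors are pairwise
  orthogonal; being N nonzero vectors in dimension N, they span. The diagonalization is thus read
  off from the given eigenpairs.\<close>

lemma eigenvector_basis:
  assumes "spectrum_at bc site \<delta> V u l \<phi>"
  defines "b \<equiv> \<lambda>k. \<phi> k /\<^sub>R norm (\<phi> k)"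
  shows "orthonormal_basis_of UNIV (b ` {1..CARD('n)})" "inj_on b {1..CARD('n)}"
    "\<And>k. k \<in> {1..CARD('n)} \<Longrightarrow> hessian_form u (b k) (b k) = l k / real CARD('n)"
    "\<And>h. hessian_form u h h = (\<Sum>c\<in>b ` {1..CARD('n)}. hessian_form u c c * (h \<bullet> c)\<^sup>2)"
proof -
  let ?I = "{1..CARD('n)}"
  have ep: "eigenpair bc site \<delta> V u (l k) (\<phi> k)" if "k \<in> ?I" for k
    using assms that by (auto simp: spectrum_at_def)
  have inj: "inj_on l ?I" using assms by (auto simp: spectrum_at_def strict_mono_on_imp_inj_on)
  have nz: "\<phi> k \<noteq> 0" if "k \<in> ?I" for k using ep[OF that] by (simp add: eigenpair_def)
  have norm_b: "norm (b k) = 1" if "k \<in> ?I" for k using nz[OF that] by (simp add: b_def)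
  have hb: "hessian_form u h (b k) = l k / real CARD('n) * (h \<bullet> b k)" if "k \<in> ?I" for h k
    using hessian_form_eigenvector[OF ep[OF that], of h]
    by (simp add: b_def linear_scale[OF linear_hessian_form])
  have orth: "b j \<bullet> b k = 0" if jk: "j \<in> ?I" "k \<in> ?I" "j \<noteq> k" for j k
  proof -
    \<comment> \<open>By symmetry both sides are the form at \<open>b j\<close> and
      \<open>b k\<close>, evaluated once through each eigenvector.\<close>
    have "l k / real CARD('n) * (b j \<bullet> b k) = l j / real CARD('n) * (b j \<bullet> b k)"
      using hb[OF jk(2), of "b j"] hb[OF jk(1), of "b k"]
      by (simp only: hessian_form_commute[of u "b j" "b k"] inner_commute[of "b k" "b j"])
    then have "(l k - l j) * (b j \<bullet> b k) = 0" by (simp add: field_simps)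
    moreover have "l k \<noteq> l j" using inj jk by (auto dest: inj_onD)
    ultimately show ?thesis by simp
  qed
  show inj_b: "inj_on b ?I"
  proof (rule inj_onI, rule ccontr)
    fix j k assume "j \<in> ?I" "k \<in> ?I" "b j = b k" "j \<noteq> k"
    then have "b k \<bullet> b k = 0" using orth[of j k] by simp
    then show False using norm_b[OF \<open>k \<in> ?I\<close>] by simp
  qed
  have po: "pairwise orthogonal (b ` ?I)"
    using orth unfolding pairwise_def orthogonal_def by blast
  have "0 \<notin> b ` ?I" using norm_b by force
  with po have ind: "independent (b ` ?I)" by (rule pairwise_orthogonal_independent)
  have "card (b ` ?I) = DIM(real ^ 'n)" using inj_b by (simp add: card_image)
  then have "span (b ` ?I) = UNIV"
    using card_eq_dim[of "b ` ?I" UNIV] ind by (auto simp: dim_UNIV)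
  with po norm_b show B: "orthonormal_basis_of UNIV (b ` ?I)"
    by (auto simp: orthonormal_basis_of_def)
  show hbb: "hessian_form u (b k) (b k) = l k / real CARD('n)" if "k \<in> ?I" for k
    using hb[OF that, of "b k"] norm_b[OF that] by (simp add: norm_eq_1)
  show "hessian_form u h h = (\<Sum>c\<in>b ` ?I. hessian_form u c c * (h \<bullet> c)\<^sup>2)" for h
  proof -
    have "hessian_form u h h = hessian_form u h (\<Sum>c\<in>b ` ?I. (h \<bullet> c) *\<^sub>R c)"
      by (simp only: orthonormal_basis_of_expand[OF B UNIV_I])
    also have "\<dots> = (\<Sum>c\<in>b ` ?I. (h \<bullet> c) * hessian_form u h c)"
      by (simp add: linear_sum[OF linear_hessian_form] linear_scale[OF linear_hessian_form])
    also have "\<dots> = (\<Sum>c\<in>b ` ?I. hessian_form u c c * (h \<bullet> c)\<^sup>2)"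
      by (intro sum.cong) (auto simp: hb norm_b[unfolded norm_eq_1] power2_eq_square)
    finally show ?thesis .
  qed
qed

section \<open>Derivative, quadratic expansion and coercivity of the energy\<close>

lemma has_derivative_potential_energy:
  "(U has_derivative (\<lambda>h. 1 / real CARD('n) * (\<Sum>i\<in>UNIV. deriv V (u $ i) * h $ i)
     + real CARD('n) * \<delta>\<^sup>2 * stiffness u h)) (at u)"
proof -
  have V: "((\<lambda>u. V (u $ i)) has_derivative (\<lambda>h. deriv V (u $ i) * h $ i)) (at u)" for i
    using has_derivative_compose[OF bounded_linear.has_derivative[OF bounded_linear_vec_nth, OF has_derivative_ident]
        smooth_funD(1)[OF V_smooth, of "u $ i", unfolded has_field_derivative_def]]
    by simp
  have S: "((\<lambda>u. stiffness u u) has_derivative (\<lambda>h. stiffness u h + stiffness h u)) (at u)"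
  proof -
    have "bounded_bilinear stiffness"
      unfolding bilinear_conv_bounded_bilinear[symmetric] bilinear_def
      using bounded_linear.linear[OF bounded_linear_stiffness]
      by (simp add: stiffness_commute[of _ y for y])
    from bounded_bilinear.FDERIV[OF this has_derivative_ident has_derivative_ident] show ?thesis .
  qed
  have "((\<lambda>u. real CARD('n) * \<delta>\<^sup>2 * stiffness u u / 2)
     has_derivative (\<lambda>h. real CARD('n) * \<delta>\<^sup>2 * stiffness u h)) (at u)"
    using has_derivative_mult_right[OF S, of "real CARD('n) * \<delta>\<^sup>2 / 2"]
    by (simp add: stiffness_commute[of _ u] mult.assoc)
  then show ?thesis
    unfolding potential_energy_eq[abs_def] by (intro derivative_intros V)
qed

lemma continuous_potential_energy: "continuous_on UNIV U"
  using has_derivative_potential_energy has_derivative_continuous by (blast intro: continuous_at_imp_continuous_on)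

text \<open>The elastic energy is exactly quadratic, so the only error is the average of the
  one-site Taylor remainders \<open>R h i\<close>. The linear terms combine to the derivative of
  \<open>U\<close>, which vanishes at a critical point.\<close>

lemma quadratic_expansion_potential_energy:
  assumes crit: "critical_point U u"
  shows "quadratic_expansion U u (\<lambda>h. hessian_form u h h)"
  unfolding quadratic_expansion_def
proof (intro allI impI)
  fix \<eta> :: real assume \<eta>: "\<eta> > 0"
  define G where "G h = 1 / real CARD('n) * (\<Sum>i\<in>UNIV. deriv V (u $ i) * h $ i)
     + real CARD('n) * \<delta>\<^sup>2 * stiffness u h" for h
  have G: "G h = 0" for h
    using has_derivative_unique[OF has_derivative_potential_energy[of u] crit[unfolded critical_point_def]]
    by (simp add: G_def fun_eq_iff)
  define R where "R h i = V (u $ i + h $ i) - V (u $ i) - deriv V (u $ i) * h $ i - deriv (deriv V) (u $ i) / 2 * (h $ i)\<^sup>2"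
    for h :: "real ^ 'n" and i
  have eq: "U (u + h) - U u - hessian_form u h h / 2 = 1 / real CARD('n) * (\<Sum>i\<in>UNIV. R h i)" for h
  proof -
    \<comment> \<open>Bookkeeping with the large sums abstracted to variables:
      \<open>g + x = 0\<close> is criticality, and \<open>s1 = s0 + 2 * x + sh\<close> expands the
      elastic form at the displaced point.\<close>
    have arith: "v1 + s1 / 2 - (v0 + s0 / 2) - (w + sh) / 2 = r"
      if "r = v1 - v0 - g - w / 2" "s1 = s0 + 2 * x + sh" "g + x = 0" for r v1 v0 g w s1 s0 x sh :: real
      using that by (simp add: field_simps)
    have "1 / real CARD('n) * (\<Sum>i\<in>UNIV. R h i) = 1 / real CARD('n) * (\<Sum>i\<in>UNIV. V (u $ i + h $ i))
      - 1 / real CARD('n) * (\<Sum>i\<in>UNIV. V (u $ i)) - 1 / real CARD('n) * (\<Sum>i\<in>UNIV. deriv V (u $ i) * h $ i)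
      - 1 / real CARD('n) * (\<Sum>i\<in>UNIV. deriv (deriv V) (u $ i) * h $ i * h $ i) / 2"
      by (simp add: R_def sum_subtractf sum_divide_distrib diff_divide_distrib power2_eq_square mult_ac)
    moreover have "real CARD('n) * \<delta>\<^sup>2 * stiffness (u + h) (u + h) = real CARD('n) * \<delta>\<^sup>2 * stiffness u u
        + 2 * (real CARD('n) * \<delta>\<^sup>2 * stiffness u h) + real CARD('n) * \<delta>\<^sup>2 * stiffness h h"
      by (simp add: stiffness_add_left stiffness_add_right stiffness_commute[of h u] algebra_simps)
    moreover note G[of h]
    ultimately show ?thesis
      unfolding potential_energy_eq hessian_form_def G_def vector_add_component by (rule arith)
  qed
  have "\<forall>\<^sub>F h in nhds 0. \<bar>R h i\<bar> \<le> \<eta> * (h $ i)\<^sup>2" for i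
  proof -
    have "((\<lambda>h. h $ i) \<longlongrightarrow> (0::real^'n) $ i) (nhds 0)" by (intro tendsto_vec_nth filterlim_ident)
    then have "filterlim (\<lambda>h::real^'n. h $ i) (nhds 0) (nhds 0)" by simp
    from eventually_compose_filterlim[OF second_order_taylor[OF smooth_funD(1)[OF V_smooth] smooth_funD(2)[OF V_smooth] \<eta>] this]
    show ?thesis unfolding R_def .
  qed
  then have "\<forall>\<^sub>F h in nhds 0. \<forall>i. \<bar>R h i\<bar> \<le> \<eta> * (h $ i)\<^sup>2" by (rule eventually_all_finite)
  then show "\<forall>\<^sub>F h in nhds 0. \<bar>U (u + h) - U u - hessian_form u h h / 2\<bar> \<le> \<eta> * (norm h)\<^sup>2"
  proof eventually_elim
    case (elim h)
    have "\<bar>\<Sum>i\<in>UNIV. R h i\<bar> \<le> (\<Sum>i\<in>UNIV. \<eta> * (h $ i)\<^sup>2)"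
      using elim by (intro order_trans[OF sum_abs] sum_mono) auto
    also have "\<dots> = \<eta> * (norm h)\<^sup>2" by (simp add: norm_vec_power2 sum_distrib_left)
    \<comment> \<open>The factor 1 / N is at most 1, so averaging over the sites keeps the
      bound.\<close>
    finally have "1 / real CARD('n) * \<bar>\<Sum>i\<in>UNIV. R h i\<bar> \<le> 1 * (\<eta> * (norm h)\<^sup>2)"
      using \<eta> by (intro mult_mono) (auto simp: Suc_le_eq)
    then show ?case unfolding eq by (simp add: abs_mult)
  qed
qed

lemma critical_point_local_minimizer:
  assumes "local_minimizer U u"
  shows "critical_point U u"
proof -
  have "eventually (\<lambda>y. U u \<le> U y) (at u)"
    using assms unfolding local_minimizer_def by (simp add: eventually_at_filter eventually_mono)
  from has_derivative_local_min[OF has_derivative_potential_energy this]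
  show ?thesis using has_derivative_potential_energy[of u] by (simp add: critical_point_def)
qed

text \<open>Summing the one-site bounds and dropping the nonnegative elastic term suffices. The
  centre \<open>c\<close> is left free because the Laplace lemmas want the bound around the saddle
  as well as around a minimizer.\<close>

lemma potential_energy_coercive:
  assumes bdd: "bdd_below (range V)" and growth: "\<exists>C>0. \<forall>\<^sub>F x in at_infinity. V x \<ge> C * x\<^sup>2"
  obtains k d where "k > 0" "\<And>u. k * (norm (u - c))\<^sup>2 - d \<le> U u"
proof -
  obtain C d where C: "C > 0" "\<And>x. C * x\<^sup>2 - d \<le> V x"
    using quadratic_lower_bound[OF bdd growth] by blast
  define N where "N = real CARD('n)"
  have N: "N > 0" by (simp add: N_def)
  \<comment> \<open>Recentring through |u - c|^2 <= 2 |u|^2 + 2 |c|^2 halves the coefficient C / N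
    and adds C |c|^2 / N to the constant.\<close>
  have "C / (2 * N) * (norm (u - c))\<^sup>2 - (C / N * (norm c)\<^sup>2 + d) \<le> U u" for u
  proof -
    have "norm (u - c) \<le> norm u + norm c" by (rule norm_triangle_ineq4)
    then have "(norm (u - c))\<^sup>2 \<le> (norm u + norm c)\<^sup>2" by (intro power_mono) auto
    also have "\<dots> \<le> 2 * (norm u)\<^sup>2 + 2 * (norm c)\<^sup>2"
      using zero_le_power2[of "norm u - norm c"] by (simp add: power2_eq_square algebra_simps)
    finally have "C / (2 * N) * (norm (u - c))\<^sup>2 \<le> C / (2 * N) * (2 * (norm u)\<^sup>2 + 2 * (norm c)\<^sup>2)"
      using C(1) N by (intro mult_left_mono) auto
    then have "C / (2 * N) * (norm (u - c))\<^sup>2 - (C / N * (norm c)\<^sup>2 + d) \<le> C / N * (norm u)\<^sup>2 - d"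
      by (simp add: add_divide_distrib distrib_left)
    also have "\<dots> = 1 / N * (\<Sum>i\<in>UNIV. C * (u $ i)\<^sup>2 - d)"
      using N by (simp add: norm_vec_power2 sum_subtractf sum_distrib_left[symmetric] N_def[symmetric] field_simps)
    also have "\<dots> \<le> 1 / N * (\<Sum>i\<in>UNIV. V (u $ i))"
      using N C(2) by (intro mult_left_mono sum_mono) auto
    also have "\<dots> \<le> U u" using stiffness_nonneg[of u] by (simp add: potential_energy_eq N_def)
    finally show ?thesis .
  qed
  moreover have "C / (2 * N) > 0" using C(1) N by simp
  ultimately show thesis using that by blast
qed

end

section \<open>Residency times\<close>

text \<open>Also true for infinite integrals, where both sides are 0 by convention. It moves
  computations to nonnegative integrals, where Tonelli and changes of variables carry no
  integrability conditions.\<close>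

lemma set_lebesgue_integral_eq_enn2real:
  fixes g :: "'a \<Rightarrow> real"
  assumes [measurable]: "A \<in> sets M" "g \<in> borel_measurable M" and g: "\<And>x. g x \<ge> 0"
  shows "(LINT x:A|M. g x) = enn2real (\<integral>\<^sup>+x. ennreal (g x) * indicator A x \<partial>M)"
  unfolding set_lebesgue_integral_def using g
  by (subst integral_eq_nn_integral)
    (auto intro!: arg_cong[where f = enn2real] nn_integral_cong simp: indicator_def)

lemma sets_hyperplane_measure [measurable_cong, simp]: "sets (hyperplane_measure a n) = sets borel"
  by (simp add: hyperplane_measure_def Let_def)

lemma hyperplane_measurable [measurable]: "hyperplane a n \<in> sets borel"
  unfolding hyperplane_def by measurable

lemma borel_measurable_fst_snd [measurable]:
  "(fst :: 'a::euclidean_space \<times> 'b::euclidean_space \<Rightarrow> 'a) \<in> borel_measurable borel"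
  "(snd :: 'a::euclidean_space \<times> 'b::euclidean_space \<Rightarrow> 'b) \<in> borel_measurable borel"
  by (intro borel_measurable_continuous_onI continuous_intros)+

section \<open>Splitting off the momenta\<close>

lemma nn_integral_lborel_times:
  fixes f :: "'a::euclidean_space \<Rightarrow> ennreal" and g :: "'b::euclidean_space \<Rightarrow> ennreal"
  assumes [measurable]: "f \<in> borel_measurable borel" "g \<in> borel_measurable borel"
  shows "(\<integral>\<^sup>+z. f (fst z) * g (snd z) \<partial>lborel) = (\<integral>\<^sup>+x. f x \<partial>lborel) * (\<integral>\<^sup>+y. g y \<partial>lborel)"
proof -
  have "(\<integral>\<^sup>+z. f (fst z) * g (snd z) \<partial>lborel)
      = (\<integral>\<^sup>+x. \<integral>\<^sup>+y. f x * g y \<partial>lborel \<partial>lborel)"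
    unfolding lborel_prod[symmetric] by (subst lborel.nn_integral_fst[symmetric]) auto
  then show ?thesis by (simp add: nn_integral_cmult nn_integral_multc)
qed

text \<open>The normal (0, \<open>\<phi>\<close>) has no momentum component, so smearing affects the
  configuration factor alone. Unfolding both surface measures with the same weight is what makes
  their independently chosen bases comparable.\<close>

lemma nn_integral_surface_element:
  fixes us \<phi> :: "real ^ 'n::finite"
  assumes \<phi>: "\<phi> \<noteq> 0" and [measurable]: "f \<in> borel_measurable borel" "g \<in> borel_measurable borel"
  shows "(\<integral>\<^sup>+z. f (fst z) * g (snd z) \<partial>surface_element us \<phi>)
    = (\<integral>\<^sup>+p. f p \<partial>lborel) * (\<integral>\<^sup>+u. g u \<partial>hyperplane_measure us \<phi>)"
proof -
  define c where "c = norm \<phi>"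
  define n where "n = \<phi> /\<^sub>R norm \<phi>"
  have c: "c > 0" and n: "norm n = 1" and \<phi>_eq: "\<phi> = c *\<^sub>R n" using \<phi> by (simp_all add: c_def n_def)
  \<comment> \<open>Only the total mass 1 of the weight matters for this comparison.\<close>
  define w where "w t = (indicator {0..1::real} t :: ennreal)" for t
  have [measurable]: "w \<in> borel_measurable borel" by (simp add: w_def[abs_def])
  have w: "(\<integral>\<^sup>+t. w t \<partial>lborel) = 1" by (simp add: w_def)
  have n0: "norm (0 :: real ^ 'n, n) = 1" using n by (simp add: norm_Pair)
  have "(0, \<phi>) = c *\<^sub>R (0 :: real ^ 'n, n)" by (simp add: \<phi>_eq)
  then have "(\<integral>\<^sup>+z. f (fst z) * g (snd z) \<partial>surface_element us \<phi>)
    = (\<integral>\<^sup>+z. f (fst z) * (g (snd z - ((snd z - us) \<bullet> n) *\<^sub>R n) * w ((snd z - us) \<bullet> n)) \<partial>lborel)"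
    unfolding surface_element_def
    by (simp only:) (subst nn_integral_hyperplane_measure[OF n0 c _ _ w], auto simp: inner_prod_def mult_ac)
  also have "\<dots> = (\<integral>\<^sup>+p. f p \<partial>lborel) * (\<integral>\<^sup>+u. g (u - ((u - us) \<bullet> n) *\<^sub>R n) * w ((u - us) \<bullet> n) \<partial>lborel)"
    by (rule nn_integral_lborel_times) auto
  also have "(\<integral>\<^sup>+u. g (u - ((u - us) \<bullet> n) *\<^sub>R n) * w ((u - us) \<bullet> n) \<partial>lborel) = (\<integral>\<^sup>+u. g u \<partial>hyperplane_measure us \<phi>)"
    unfolding \<phi>_eq by (subst nn_integral_hyperplane_measure[OF n c _ _ w]) auto
  finally show ?thesis .
qed

text \<open>Both integrals factor over a basis containing \<open>n\<close> and differ only in the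
  factor along \<open>n\<close>. \<open>K\<close> collects the other directions; its positivity is
  all that is recorded, since it cancels in the residency time.\<close>

lemma nn_integral_gaussian_flux:
  fixes n :: "'a::euclidean_space"
  assumes n: "norm n = 1" and m: "m > 0"
  obtains K where "K > 0"
    "(\<integral>\<^sup>+p. ennreal (exp (- (m / 2 * (norm (p :: 'a))\<^sup>2))) \<partial>lborel) = ennreal (K * sqrt (2 * pi / m))"
    "(\<integral>\<^sup>+p. ennreal (max (p \<bullet> n) 0 * exp (- (m / 2 * (norm p)\<^sup>2))) \<partial>lborel) = ennreal (K / m)"
proof -
  have "subspace {x. x \<bullet> n = 0}" by (auto simp: subspace_def inner_simps)
  then obtain B where B: "orthonormal_basis_of {x. x \<bullet> n = 0} B"
    using orthonormal_basis_of_exists by blast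
  note I = orthonormal_basis_of_insert_normal[OF B n]
  note D = orthonormal_basis_ofD[OF I(1)]
  define K where "K = sqrt (2 * pi / m) ^ card B"
  have K: "K > 0" using m by (simp add: K_def)
  have norm2: "(norm p)\<^sup>2 = (\<Sum>b\<in>insert n B. (p \<bullet> b)\<^sup>2)" for p
    unfolding power2_norm_eq_inner using orthonormal_basis_of_inner[OF I(1), of p p]
    by (simp add: power2_eq_square)
  have exp_eq: "exp (- (m / 2 * (norm p)\<^sup>2)) = (\<Prod>b\<in>insert n B. exp (- (m / 2 * (p \<bullet> b)\<^sup>2)))" for p
    unfolding norm2 using D(1) by (simp only: sum_distrib_left sum_negf[symmetric] exp_sum)
  \<comment> \<open>The weight \<open>r\<close> enters along \<open>n\<close> only: the constant 1
    gives the mass, the positive part gives the flux.\<close>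
  define F where "F r b t = ennreal ((if b = n then r t else 1) * exp (- (m / 2 * t\<^sup>2)))"
    for r :: "real \<Rightarrow> real" and b :: 'a and t :: real
  have *: "(\<integral>\<^sup>+p. ennreal (r (p \<bullet> n) * exp (- (m / 2 * (norm p)\<^sup>2))) \<partial>lborel)
      = (\<integral>\<^sup>+t. ennreal (r t * exp (- (m / 2 * t\<^sup>2))) \<partial>lborel) * ennreal K"
    if r [measurable]: "r \<in> borel_measurable borel" and r0: "\<And>t. r t \<ge> 0" for r
  proof -
    have fin: "finite B" using D(1) by simp
    have "ennreal (r (p \<bullet> n) * exp (- (m / 2 * (norm p)\<^sup>2))) = (\<Prod>b\<in>insert n B. F r b (p \<bullet> b))" for p
    proof -
      have "(\<Prod>b\<in>B. (if b = n then r (p \<bullet> b) else 1) * exp (- (m / 2 * (p \<bullet> b)\<^sup>2)))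
          = (\<Prod>b\<in>B. exp (- (m / 2 * (p \<bullet> b)\<^sup>2)))"
        using I(2) by (intro prod.cong) auto
      then have "r (p \<bullet> n) * exp (- (m / 2 * (norm p)\<^sup>2))
          = (\<Prod>b\<in>insert n B. (if b = n then r (p \<bullet> b) else 1) * exp (- (m / 2 * (p \<bullet> b)\<^sup>2)))"
        unfolding exp_eq using fin I(2) by simp
      also have "ennreal \<dots> = (\<Prod>b\<in>insert n B. F r b (p \<bullet> b))"
        unfolding F_def using r0 by (intro prod_ennreal[symmetric]) auto
      finally show ?thesis .
    qed
    then have "(\<integral>\<^sup>+p. ennreal (r (p \<bullet> n) * exp (- (m / 2 * (norm p)\<^sup>2))) \<partial>lborel)
        = (\<Prod>b\<in>insert n B. \<integral>\<^sup>+t. F r b t \<partial>lborel)"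
      by (simp only:) (intro nn_integral_lborel_prod_orthonormal_basis[OF I(1)], auto simp: F_def)
    also have "\<dots> = (\<integral>\<^sup>+t. F r n t \<partial>lborel) * (\<Prod>b\<in>B. \<integral>\<^sup>+t. F r b t \<partial>lborel)"
      using fin I(2) by simp
    also have "(\<Prod>b\<in>B. \<integral>\<^sup>+t. F r b t \<partial>lborel) = (\<Prod>b\<in>B. ennreal (sqrt (2 * pi / m)))"
    proof (intro prod.cong refl)
      fix b assume "b \<in> B"
      then have "b \<noteq> n" using I(2) by auto
      then show "(\<integral>\<^sup>+t. F r b t \<partial>lborel) = ennreal (sqrt (2 * pi / m))"
        using nn_integral_gaussian[OF m] by (simp add: F_def)
    qed
    also have "\<dots> = ennreal K" using m by (simp add: K_def ennreal_power)
    finally show ?thesis by (simp add: F_def)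
  qed
  have "(\<integral>\<^sup>+p. ennreal (exp (- (m / 2 * (norm (p :: 'a))\<^sup>2))) \<partial>lborel) = ennreal (sqrt (2 * pi / m)) * ennreal K"
    using *[of "\<lambda>_. 1", OF borel_measurable_const zero_le_one] by (simp only: mult_1 nn_integral_gaussian[OF m])
  also have "\<dots> = ennreal (K * sqrt (2 * pi / m))"
    using K m by (subst ennreal_mult[symmetric]) (auto simp: mult.commute)
  finally have "(\<integral>\<^sup>+p. ennreal (exp (- (m / 2 * (norm (p :: 'a))\<^sup>2))) \<partial>lborel) = ennreal (K * sqrt (2 * pi / m))" .
  moreover have "(\<integral>\<^sup>+p. ennreal (max (p \<bullet> n) 0 * exp (- (m / 2 * (norm p)\<^sup>2))) \<partial>lborel) = ennreal (1 / m) * ennreal K"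
    using *[of "\<lambda>t. max t 0"] by (simp only: nn_integral_gaussian_first_moment[OF m]) simp
  moreover have "ennreal (1 / m) * ennreal K = ennreal (K / m)"
    using K m by (subst ennreal_mult[symmetric]) auto
  ultimately show thesis using K by (intro that[of K]) simp_all
qed

text \<open>With \<open>m = \<beta> / N\<close> the momentum factors are
  \<open>K * sqrt (2 * pi / m)\<close> for the region and \<open>K / m\<close> for the flux;
  \<open>K\<close> and the total mass cancel, which leaves sqrt (2 pi m).\<close>

lemma residency_time_eq:
  fixes U :: "real ^ 'n::finite \<Rightarrow> real"
  assumes U [measurable]: "U \<in> borel_measurable borel" and \<phi>: "\<phi> \<noteq> 0" and \<beta>: "\<beta> > 0"
    and int: "integrable lborel (\<lambda>u. exp (- \<beta> * U u))"
  shows "residency_time U us \<phi> s \<beta> = sqrt (2 * pi * \<beta> / real CARD('n)) *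
    ((LINT u:half_space s us \<phi>|lborel. exp (- \<beta> * U u)) /
     (LINT u:hyperplane us \<phi>|hyperplane_measure us \<phi>. exp (- \<beta> * U u)))"
proof -
  define m where "m = \<beta> / real CARD('n)"
  have m: "m > 0" using \<beta> by (simp add: m_def)
  define n where "n = \<phi> /\<^sub>R norm \<phi>"
  have n: "norm n = 1" using \<phi> by (simp add: n_def)
  obtain K where K: "K > 0"
    "(\<integral>\<^sup>+p. ennreal (exp (- (m / 2 * (norm (p :: real ^ 'n))\<^sup>2))) \<partial>lborel) = ennreal (K * sqrt (2 * pi / m))"
    "(\<integral>\<^sup>+p. ennreal (max (p \<bullet> n) 0 * exp (- (m / 2 * (norm p)\<^sup>2))) \<partial>lborel) = ennreal (K / m)"
    using nn_integral_gaussian_flux[OF n m] by blast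
  have H: "exp (- \<beta> * hamiltonian U z) = exp (- (m / 2 * (norm (fst z))\<^sup>2)) * exp (- \<beta> * U (snd z))" for z
    by (cases z) (simp add: hamiltonian_def norm_vec_power2 m_def exp_add[symmetric] algebra_simps)
  have part: "partition_fun U \<beta> (UNIV \<times> D) = K * sqrt (2 * pi / m) * (LINT u:D|lborel. exp (- \<beta> * U u))"
    if [measurable]: "D \<in> sets borel" for D
  proof -
    have [measurable]: "(UNIV :: (real ^ 'n) set) \<times> D \<in> sets borel"
      using that by (simp add: borel_prod[symmetric])
    have "partition_fun U \<beta> ((UNIV :: (real ^ 'n) set) \<times> D)
       = (LINT z:(UNIV :: (real ^ 'n) set) \<times> D|lborel. exp (- (m / 2 * (norm (fst z))\<^sup>2)) * exp (- \<beta> * U (snd z)))"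
      by (simp only: partition_fun_def H case_prod_beta' fst_conv snd_conv)
    also have "\<dots> = enn2real (\<integral>\<^sup>+z. ennreal (exp (- (m / 2 * (norm (fst z))\<^sup>2)) * exp (- \<beta> * U (snd z)))
        * indicator ((UNIV :: (real ^ 'n) set) \<times> D) z \<partial>lborel)"
      by (rule set_lebesgue_integral_eq_enn2real) auto
    also have "(\<integral>\<^sup>+z. ennreal (exp (- (m / 2 * (norm (fst z))\<^sup>2)) * exp (- \<beta> * U (snd z)))
        * indicator ((UNIV :: (real ^ 'n) set) \<times> D) z \<partial>lborel)
      = (\<integral>\<^sup>+z. ennreal (exp (- (m / 2 * (norm (fst z :: real ^ 'n))\<^sup>2))) * (ennreal (exp (- \<beta> * U (snd z))) * indicator D (snd z)) \<partial>lborel)"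
      by (intro nn_integral_cong) (auto simp: ennreal_mult indicator_def)
    also have "\<dots> = ennreal (K * sqrt (2 * pi / m)) * (\<integral>\<^sup>+u. ennreal (exp (- \<beta> * U u)) * indicator D u \<partial>lborel)"
      unfolding K(2)[symmetric] by (rule nn_integral_lborel_times) auto
    also have "enn2real \<dots> = K * sqrt (2 * pi / m) * (LINT u:D|lborel. exp (- \<beta> * U u))"
      using K(1) m by (subst set_lebesgue_integral_eq_enn2real) (auto simp: enn2real_mult)
    finally show ?thesis .
  qed
  have region: "partition_fun U \<beta> (region s us \<phi>)
      = K * sqrt (2 * pi / m) * (LINT u:half_space s us \<phi>|lborel. exp (- \<beta> * U u))"
  proof -
    have "region s us \<phi> = UNIV \<times> half_space s us \<phi>" by (auto simp: region_def half_space_def)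
    moreover have "half_space s us \<phi> \<in> sets borel" unfolding half_space_def by measurable
    ultimately show ?thesis using part by simp
  qed
  \<comment> \<open>As division by 0 yields 0, the total mass cancels only once it is known to be
    nonzero.\<close>
  have total: "partition_fun U \<beta> UNIV \<noteq> 0"
  proof -
    have "\<not> (AE u in (lborel :: (real ^ 'n) measure). exp (- \<beta> * U u) = 0)"
      by (simp add: AE_iff_measurable[OF _ refl])
    then have "(\<integral>u. exp (- \<beta> * U u) \<partial>lborel) \<noteq> 0"
      using integral_nonneg_eq_0_iff_AE[OF int] by simp
    then show ?thesis
      using part[of UNIV] K(1) m by (simp add: set_lebesgue_integral_def)
  qed
  have crossing: "(LINT (p, u):dividing_surface us \<phi>|surface_element us \<phi>.
       max (p \<bullet> (\<phi> /\<^sub>R norm \<phi>)) 0 * exp (- \<beta> * hamiltonian U (p, u)))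
     = K / m * (LINT u:hyperplane us \<phi>|hyperplane_measure us \<phi>. exp (- \<beta> * U u))"
  proof -
    have sets: "sets (surface_element us \<phi>) = sets borel" by (simp add: surface_element_def)
    have [measurable]: "dividing_surface us \<phi> \<in> sets borel"
      by (simp add: dividing_surface_eq_hyperplane hyperplane_measurable)
    have "(LINT (p, u):dividing_surface us \<phi>|surface_element us \<phi>.
        max (p \<bullet> (\<phi> /\<^sub>R norm \<phi>)) 0 * exp (- \<beta> * hamiltonian U (p, u)))
      = (LINT z:dividing_surface us \<phi>|surface_element us \<phi>.
        max (fst z \<bullet> n) 0 * exp (- (m / 2 * (norm (fst z))\<^sup>2)) * exp (- \<beta> * U (snd z)))"
      by (simp only: H n_def case_prod_beta' mult.assoc fst_conv snd_conv)
    also have "\<dots> = enn2real (\<integral>\<^sup>+z. ennreal (max (fst z \<bullet> n) 0 * exp (- (m / 2 * (norm (fst z))\<^sup>2)) * exp (- \<beta> * U (snd z)))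
        * indicator (dividing_surface us \<phi>) z \<partial>surface_element us \<phi>)"
      by (rule set_lebesgue_integral_eq_enn2real) (auto simp: sets cong: measurable_cong_sets)
    also have "(\<integral>\<^sup>+z. ennreal (max (fst z \<bullet> n) 0 * exp (- (m / 2 * (norm (fst z))\<^sup>2)) * exp (- \<beta> * U (snd z)))
        * indicator (dividing_surface us \<phi>) z \<partial>surface_element us \<phi>)
      = (\<integral>\<^sup>+z. ennreal (max (fst z \<bullet> n) 0 * exp (- (m / 2 * (norm (fst z))\<^sup>2)))
          * (ennreal (exp (- \<beta> * U (snd z))) * indicator (hyperplane us \<phi>) (snd z)) \<partial>surface_element us \<phi>)"
      by (intro nn_integral_cong) (auto simp: ennreal_mult indicator_def dividing_surface_def hyperplane_def)
    also have "\<dots> = ennreal (K / m) * (\<integral>\<^sup>+u. ennreal (exp (- \<beta> * U u)) * indicator (hyperplane us \<phi>) u \<partial>hyperplane_measure us \<phi>)"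
      unfolding K(3)[symmetric] by (rule nn_integral_surface_element[OF \<phi>]) auto
    also have "enn2real \<dots> = K / m * (LINT u:hyperplane us \<phi>|hyperplane_measure us \<phi>. exp (- \<beta> * U u))"
      using K(1) m by (subst set_lebesgue_integral_eq_enn2real) (auto simp: enn2real_mult)
    finally show ?thesis .
  qed
  have "sqrt (2 * pi / m) * m = sqrt (2 * pi * m)"
  proof -
    have "sqrt (2 * pi / m) * m = sqrt (2 * pi) * (m / sqrt m)" by (simp add: real_sqrt_divide)
    then show ?thesis using m by (simp add: real_div_sqrt real_sqrt_mult)
  qed
  then have "K * sqrt (2 * pi / m) / (K / m) = sqrt (2 * pi * m)" using K(1) m by (simp add: field_simps)
  then have ratio: "K * sqrt (2 * pi / m) / (K / m) = sqrt (2 * pi * \<beta> / real CARD('n))"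
    by (simp add: m_def)
  have "x * I / (Z * (y * Y / Z)) = x / y * (I / Y)" if "Z \<noteq> 0" for x y I Y Z :: real
    using that by simp
  from this[OF total] show ?thesis
    unfolding residency_time_def crossing_frequency_def crossing region ratio[symmetric] .
qed

section \<open>Laplace asymptotics on the half-space and on the hyperplane\<close>

lemma laplace_open_set:
  fixes B :: "'a::euclidean_space set"
  assumes B: "orthonormal_basis_of UNIV B" and \<mu>: "\<And>b. b \<in> B \<Longrightarrow> \<mu> b > 0"
    and f [measurable]: "f \<in> borel_measurable borel"
    and expansion: "quadratic_expansion f x (\<lambda>h. \<Sum>b\<in>B. \<mu> b * (h \<bullet> b)\<^sup>2)"
    and D: "open D" and x: "x \<in> D"
    and coercive: "k > 0" "\<And>y. k * (norm (y - x))\<^sup>2 - d \<le> f y"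
    and conc: "concentrates lborel D f x"
  shows "((\<lambda>\<beta>. sqrt \<beta> ^ DIM('a) * exp (\<beta> * f x) * (LINT y:D|lborel. exp (- \<beta> * f y)))
    \<longlongrightarrow> (\<Prod>b\<in>B. sqrt (2 * pi / \<mu> b))) at_top"
proof -
  obtain e where e: "e > 0"
    and lower: "\<And>h. norm h < e \<Longrightarrow> f x + (\<Sum>b\<in>B. \<mu> b * (h \<bullet> b)\<^sup>2) / 4 \<le> f (x + h)"
    using quadratic_expansion_lower_bound[OF B \<mu> expansion] by (auto simp: eventually_nhds_metric)
  obtain r where r: "r > 0" "ball x r \<subseteq> D" using D x open_contains_ball by blast
  \<comment> \<open>Radius e / 2 keeps the closed ball inside the region of the lower bound and
    makes \<open>D - A\<close> the tail set of \<open>concentrates\<close> for epsilon = e /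
    2.\<close>
  define A where "A = D \<inter> {y. norm (y - x) \<le> e / 2}"
  have [measurable]: "D \<in> sets borel" using D by simp
  have A: "A \<in> sets borel" unfolding A_def by measurable
  obtain K c \<beta>0 where tail: "c > 0" "\<And>\<beta>. \<beta> > \<beta>0 \<Longrightarrow>
      (LINT u:D \<inter> {u. norm (u - x) > e / 2}|lborel. exp (- \<beta> * f u)) / (LINT u:D|lborel. exp (- \<beta> * f u))
         \<le> K * exp (- c * \<beta>)"
    using conc[unfolded concentrates_def, rule_format, of "e / 2"] e by auto
  have DA: "D - A = D \<inter> {u. norm (u - x) > e / 2}" by (auto simp: A_def)
  show ?thesis
  proof (rule laplace_concentrated[OF B \<mu> f expansion A])
    have "ball x (min r (e / 2)) \<subseteq> A"
      using r by (auto simp: A_def dist_norm norm_minus_commute)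
    then show "x \<in> interior A" using r e by (intro interiorI[of "ball x (min r (e / 2))"]) auto
    show "integrable lborel (\<lambda>y. exp (- \<beta> * f y))" if "\<beta> > 0" for \<beta>
      by (rule integrable_exp_coercive[OF f coercive(1) that coercive(2)])
    show "f x + (\<Sum>b\<in>B. \<mu> b * (h \<bullet> b)\<^sup>2) / 4 \<le> f (x + h)" if "x + h \<in> A" for h
      using that e by (intro lower) (auto simp: A_def)
    show "(LINT y:D - A|lborel. exp (- \<beta> * f y)) / (LINT y:D|lborel. exp (- \<beta> * f y)) \<le> K * exp (- c * \<beta>)"
      if "\<beta> > \<beta>0" for \<beta> unfolding DA by (rule tail(2)[OF that])
  qed (use tail(1) in \<open>auto simp: A_def\<close>)
qed

text \<open>The smearing weight is the normal density of variance 1 / beta, so it merges with exp (-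
  beta f) into one Boltzmann factor at the same beta; its normalization is the prefactor. The set
  \<open>S\<close> is carried along so that the total and the tail convert by the same
  formula.\<close>

lemma hyperplane_integral_exp:
  fixes f :: "'a::euclidean_space \<Rightarrow> real"
  assumes n: "norm n = 1" and c: "c > 0" and \<beta>: "\<beta> > 0"
    and [measurable]: "f \<in> borel_measurable borel" "S \<in> sets borel"
  shows "(LINT u:hyperplane a (c *\<^sub>R n) \<inter> S|hyperplane_measure a (c *\<^sub>R n). exp (- \<beta> * f u))
    = sqrt (\<beta> / (2 * pi)) * (LINT x:{x. x - ((x - a) \<bullet> n) *\<^sub>R n \<in> S}|lborel.
        exp (- \<beta> * (f (x - ((x - a) \<bullet> n) *\<^sub>R n) + ((x - a) \<bullet> n)\<^sup>2 / 2)))"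
proof -
  define P where "P x = x - ((x - a) \<bullet> n) *\<^sub>R n" for x
  have [measurable]: "P \<in> borel_measurable borel" unfolding P_def[abs_def] by measurable
  have [measurable]: "P -` S \<in> sets borel"
    using measurable_sets[of P borel borel S] by simp
  have P: "P x \<in> hyperplane a (c *\<^sub>R n)" for x
    using n by (simp add: hyperplane_def P_def inner_simps norm_eq_1 algebra_simps)
  define w where "w t = ennreal (sqrt (\<beta> / (2 * pi))) * ennreal (exp (- (\<beta> / 2 * t\<^sup>2)))" for t :: real
  have [measurable]: "w \<in> borel_measurable borel" unfolding w_def[abs_def] by measurable
  have "sqrt (\<beta> / (2 * pi)) * sqrt (2 * pi / \<beta>) = 1" using \<beta> by (simp flip: real_sqrt_mult)
  moreover have "(\<integral>\<^sup>+t. w t \<partial>lborel) = ennreal (sqrt (\<beta> / (2 * pi))) * (\<integral>\<^sup>+t. ennreal (exp (- (\<beta> / 2 * t\<^sup>2))) \<partial>lborel)"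
    unfolding w_def by (rule nn_integral_cmult) measurable
  moreover have "\<dots> = ennreal (sqrt (\<beta> / (2 * pi)) * sqrt (2 * pi / \<beta>))"
    unfolding nn_integral_gaussian[OF \<beta>] using \<beta> by (intro ennreal_mult[symmetric]) auto
  ultimately have w: "(\<integral>\<^sup>+t. w t \<partial>lborel) = 1" by (simp only: ennreal_1)
  have "(LINT u:hyperplane a (c *\<^sub>R n) \<inter> S|hyperplane_measure a (c *\<^sub>R n). exp (- \<beta> * f u))
    = enn2real (\<integral>\<^sup>+u. ennreal (exp (- \<beta> * f u)) * indicator (hyperplane a (c *\<^sub>R n) \<inter> S) u \<partial>hyperplane_measure a (c *\<^sub>R n))"
    by (rule set_lebesgue_integral_eq_enn2real) auto
  also have "(\<integral>\<^sup>+u. ennreal (exp (- \<beta> * f u)) * indicator (hyperplane a (c *\<^sub>R n) \<inter> S) u \<partial>hyperplane_measure a (c *\<^sub>R n))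
    = (\<integral>\<^sup>+x. ennreal (exp (- \<beta> * f (P x))) * indicator (hyperplane a (c *\<^sub>R n) \<inter> S) (P x) * w ((x - a) \<bullet> n) \<partial>lborel)"
    unfolding P_def by (rule nn_integral_hyperplane_measure[OF n c _ _ w]) auto
  also have "\<dots> = (\<integral>\<^sup>+x. ennreal (sqrt (\<beta> / (2 * pi)))
      * (ennreal (exp (- \<beta> * (f (P x) + ((x - a) \<bullet> n)\<^sup>2 / 2))) * indicator (P -` S) x) \<partial>lborel)"
  proof (intro nn_integral_cong)
    fix x
    have "exp (- \<beta> * (f (P x) + ((x - a) \<bullet> n)\<^sup>2 / 2)) = exp (- \<beta> * f (P x)) * exp (- (\<beta> / 2 * ((x - a) \<bullet> n)\<^sup>2))"
      by (simp add: exp_add[symmetric] algebra_simps)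
    then show "ennreal (exp (- \<beta> * f (P x))) * indicator (hyperplane a (c *\<^sub>R n) \<inter> S) (P x) * w ((x - a) \<bullet> n)
      = ennreal (sqrt (\<beta> / (2 * pi))) * (ennreal (exp (- \<beta> * (f (P x) + ((x - a) \<bullet> n)\<^sup>2 / 2))) * indicator (P -` S) x)"
      using P[of x] by (simp add: w_def ennreal_mult mult_ac split: split_indicator)
  qed
  also have "\<dots> = ennreal (sqrt (\<beta> / (2 * pi)))
      * (\<integral>\<^sup>+x. ennreal (exp (- \<beta> * (f (P x) + ((x - a) \<bullet> n)\<^sup>2 / 2))) * indicator (P -` S) x \<partial>lborel)"
    by (rule nn_integral_cmult) measurable
  also have "enn2real \<dots> = sqrt (\<beta> / (2 * pi)) * (LINT x:P -` S|lborel. exp (- \<beta> * (f (P x) + ((x - a) \<bullet> n)\<^sup>2 / 2)))"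
    using \<beta> by (subst set_lebesgue_integral_eq_enn2real) (auto simp: enn2real_mult)
  also have "P -` S = {x. P x \<in> S}" by auto
  finally show ?thesis by (simp only: P_def)
qed

text \<open>Adding half the square of the normal coordinate to the restriction of \<open>f\<close> reduces the
  Laplace asymptotics on the hyperplane to those on the whole space.\<close>

lemma laplace_hyperplane:
  fixes B :: "'a::euclidean_space set"
  assumes B: "orthonormal_basis_of UNIV B" and n: "n \<in> B" and \<mu>: "\<And>b. b \<in> B - {n} \<Longrightarrow> \<mu> b > 0"
    and f [measurable]: "f \<in> borel_measurable borel"
    and expansion: "quadratic_expansion f a (\<lambda>h. \<Sum>b\<in>B. \<mu> b * (h \<bullet> b)\<^sup>2)"
    and coercive: "k > 0" "\<And>y. k * (norm (y - a))\<^sup>2 - d \<le> f y"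
    and c: "c > 0"
    and conc: "concentrates (hyperplane_measure a (c *\<^sub>R n)) (hyperplane a (c *\<^sub>R n)) f a"
  shows "((\<lambda>\<beta>. sqrt \<beta> ^ DIM('a) * exp (\<beta> * f a) *
      ((LINT u:hyperplane a (c *\<^sub>R n)|hyperplane_measure a (c *\<^sub>R n). exp (- \<beta> * f u)) / sqrt \<beta>))
    \<longlongrightarrow> (\<Prod>b\<in>B - {n}. sqrt (2 * pi / \<mu> b))) at_top"
proof -
  note D = orthonormal_basis_ofD[OF B]
  have nn: "n \<bullet> n = 1" and norm_n: "norm n = 1" using D(3)[OF n n] by (simp_all add: norm_eq_1)
  define P where "P x = x - ((x - a) \<bullet> n) *\<^sub>R n" for x
  define Q where "Q h = h - (h \<bullet> n) *\<^sub>R n" for h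
  \<comment> \<open>The eigenvalue along \<open>n\<close> becomes 1, the coefficient in the added
    term (h . n)^2 / 2; the others are kept.\<close>
  define \<mu>' where "\<mu>' = \<mu>(n := 1)"
  define g where "g x = f (P x) + ((x - a) \<bullet> n)\<^sup>2 / 2" for x
  have [measurable]: "P \<in> borel_measurable borel" unfolding P_def[abs_def] by measurable
  have g [measurable]: "g \<in> borel_measurable borel" unfolding g_def[abs_def] by measurable
  have \<mu>': "\<mu>' b > 0" if "b \<in> B" for b using \<mu> that by (auto simp: \<mu>'_def)
  have P: "P (a + h) = a + Q h" for h by (simp add: P_def Q_def)
  have Qb: "Q h \<bullet> b = (if b = n then 0 else h \<bullet> b)" if "b \<in> B" for h b
    using D(3)[OF n that] nn by (auto simp: Q_def inner_simps)
  have norm_Q: "(norm h)\<^sup>2 = (norm (Q h))\<^sup>2 + (h \<bullet> n)\<^sup>2" for h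
    unfolding power2_norm_eq_inner Q_def
    by (simp add: inner_diff_left inner_diff_right inner_commute[of n h] nn power2_eq_square)
  have norm_Q_le: "norm (Q h) \<le> norm h" for h
    using norm_Q[of h] by (auto intro: power2_le_imp_le[OF _ norm_ge_zero])
  have sum_Q: "(\<Sum>b\<in>B. \<nu> b * (Q h \<bullet> b)\<^sup>2) = (\<Sum>b\<in>B - {n}. \<nu> b * (h \<bullet> b)\<^sup>2)" for \<nu> h
    using D(1) n by (subst sum.remove[of _ n]) (auto simp: Qb intro!: sum.cong)
  have sum_\<mu>': "(\<Sum>b\<in>B. \<mu>' b * (h \<bullet> b)\<^sup>2) = (h \<bullet> n)\<^sup>2 + (\<Sum>b\<in>B - {n}. \<mu> b * (h \<bullet> b)\<^sup>2)" for h
    using D(1) n by (subst sum.remove[of _ n]) (auto simp: \<mu>'_def intro!: sum.cong)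
  have g_eq: "g (a + h) = f (a + Q h) + (h \<bullet> n)\<^sup>2 / 2" for h by (simp add: g_def P)
  have Q0: "Q 0 = 0" by (simp add: Q_def)
  have ga: "g a = f a" using g_eq[of 0] by (simp add: Q0)
  have expansion': "quadratic_expansion g a (\<lambda>h. \<Sum>b\<in>B. \<mu>' b * (h \<bullet> b)\<^sup>2)"
    unfolding quadratic_expansion_def
  proof (intro allI impI)
    fix \<eta> :: real assume \<eta>: "\<eta> > 0"
    have "(Q \<longlongrightarrow> Q 0) (nhds 0)" unfolding Q_def[abs_def] by (intro tendsto_intros filterlim_ident)
    then have lim: "filterlim Q (nhds 0) (nhds 0)" by (simp add: Q0)
    have "\<forall>\<^sub>F h in nhds 0. \<bar>f (a + h) - f a - (\<Sum>b\<in>B. \<mu> b * (h \<bullet> b)\<^sup>2) / 2\<bar> \<le> \<eta> * (norm h)\<^sup>2"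
      using expansion \<eta> by (simp add: quadratic_expansion_def)
    from eventually_compose_filterlim[OF this lim]
    show "\<forall>\<^sub>F h in nhds 0. \<bar>g (a + h) - g a - (\<Sum>b\<in>B. \<mu>' b * (h \<bullet> b)\<^sup>2) / 2\<bar> \<le> \<eta> * (norm h)\<^sup>2"
    proof eventually_elim
      case (elim h)
      have "g (a + h) - g a - (\<Sum>b\<in>B. \<mu>' b * (h \<bullet> b)\<^sup>2) / 2
          = f (a + Q h) - f a - (\<Sum>b\<in>B. \<mu> b * (Q h \<bullet> b)\<^sup>2) / 2"
        by (simp add: g_eq ga sum_\<mu>' sum_Q add_divide_distrib)
      then have "\<bar>g (a + h) - g a - (\<Sum>b\<in>B. \<mu>' b * (h \<bullet> b)\<^sup>2) / 2\<bar> \<le> \<eta> * (norm (Q h))\<^sup>2"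
        using elim by simp
      also have "\<dots> \<le> \<eta> * (norm h)\<^sup>2" using \<eta> norm_Q_le by (intro mult_left_mono power_mono) auto
      finally show ?case .
    qed
  qed
  obtain e where e: "e > 0"
    and lower: "\<And>h. norm h < e \<Longrightarrow> g a + (\<Sum>b\<in>B. \<mu>' b * (h \<bullet> b)\<^sup>2) / 4 \<le> g (a + h)"
    using quadratic_expansion_lower_bound[OF B \<mu>' expansion'] by (auto simp: eventually_nhds_metric)
  \<comment> \<open>A cylinder, unbounded along \<open>n\<close>: only the tangential distance is
    restricted, so that the complement is the preimage under \<open>P\<close> of the tail set in
    \<open>concentrates\<close>.\<close>
  define A where "A = {x. norm (P x - a) \<le> e / 2}"
  have A: "A \<in> sets borel" unfolding A_def by measurable
  let ?D = "\<lambda>\<beta>. LINT u:hyperplane a (c *\<^sub>R n)|hyperplane_measure a (c *\<^sub>R n). exp (- \<beta> * f u)"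
  obtain K c' \<beta>0 where tail: "c' > 0" "\<beta>0 > 0" "\<And>\<beta>. \<beta> > \<beta>0 \<Longrightarrow>
      (LINT u:hyperplane a (c *\<^sub>R n) \<inter> {u. norm (u - a) > e / 2}|hyperplane_measure a (c *\<^sub>R n). exp (- \<beta> * f u)) / ?D \<beta>
         \<le> K * exp (- c' * \<beta>)"
    using conc[unfolded concentrates_def, rule_format, of "e / 2"] e by auto
  have full: "?D \<beta> = sqrt (\<beta> / (2 * pi)) * (LINT x:UNIV|lborel. exp (- \<beta> * g x))" if "\<beta> > 0" for \<beta>
    using hyperplane_integral_exp[OF norm_n c that f, of UNIV a] by (simp add: g_def P_def)
  have far: "(LINT u:hyperplane a (c *\<^sub>R n) \<inter> {u. norm (u - a) > e / 2}|hyperplane_measure a (c *\<^sub>R n). exp (- \<beta> * f u))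
      = sqrt (\<beta> / (2 * pi)) * (LINT x:UNIV - A|lborel. exp (- \<beta> * g x))" if "\<beta> > 0" for \<beta>
  proof -
    have "UNIV - A = {x. P x \<in> {u. norm (u - a) > e / 2}}" by (auto simp: A_def)
    moreover have "{u. norm (u - a) > e / 2} \<in> sets borel" by measurable
    ultimately show ?thesis
      using hyperplane_integral_exp[OF norm_n c that f, of "{u. norm (u - a) > e / 2}" a]
      by (simp add: g_def P_def)
  qed
  have main: "((\<lambda>\<beta>. sqrt \<beta> ^ DIM('a) * exp (\<beta> * g a) * (LINT x:UNIV|lborel. exp (- \<beta> * g x)))
    \<longlongrightarrow> (\<Prod>b\<in>B. sqrt (2 * pi / \<mu>' b))) at_top"
  proof (rule laplace_concentrated[OF B \<mu>' g expansion' A])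
    have "ball a (e / 2) \<subseteq> A"
    proof
      fix x assume "x \<in> ball a (e / 2)"
      then show "x \<in> A" using P[of "x - a"] norm_Q_le[of "x - a"]
        by (simp add: A_def dist_norm norm_minus_commute)
    qed
    then show "a \<in> interior A" using e by (intro interiorI[of "ball a (e / 2)"]) auto
    show "integrable lborel (\<lambda>y. exp (- \<beta> * g y))" if "\<beta> > 0" for \<beta>
    proof (rule integrable_exp_coercive[OF g _ that])
      show "min k (1 / 2) > 0" using coercive(1) by simp
      show "min k (1 / 2) * (norm (x - a))\<^sup>2 - d \<le> g x" for x
      proof -
        have "min k (1 / 2) * (norm (x - a))\<^sup>2
            \<le> k * (norm (Q (x - a)))\<^sup>2 + 1 / 2 * ((x - a) \<bullet> n)\<^sup>2"
          unfolding norm_Q[of "x - a"] distrib_left by (intro add_mono mult_right_mono) auto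
        moreover have "k * (norm (Q (x - a)))\<^sup>2 - d \<le> f (a + Q (x - a))"
          using coercive(2)[of "a + Q (x - a)"] by simp
        ultimately show ?thesis using g_eq[of "x - a"] by simp
      qed
    qed
    \<comment> \<open>Since \<open>A\<close> is unbounded along \<open>n\<close>, the local bound is
      applied to the projection \<open>Q h\<close> only; along \<open>n\<close> the added term is
      exactly quadratic, and its 1/2 exceeds the required 1/4.\<close>
    show "g a + (\<Sum>b\<in>B. \<mu>' b * (h \<bullet> b)\<^sup>2) / 4 \<le> g (a + h)" if "a + h \<in> A" for h
    proof -
      have QQ: "Q (Q h) = Q h" using nn by (simp add: Q_def inner_simps)
      have Qn: "Q h \<bullet> n = 0" using Qb[OF n] by simp
      have "norm (Q h) < e" using that e by (simp add: A_def P)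
      from lower[OF this] have "g a + (\<Sum>b\<in>B - {n}. \<mu>' b * (h \<bullet> b)\<^sup>2) / 4 \<le> f (a + Q h)"
        by (simp add: sum_Q g_eq QQ Qn)
      moreover have "(\<Sum>b\<in>B - {n}. \<mu>' b * (h \<bullet> b)\<^sup>2) = (\<Sum>b\<in>B - {n}. \<mu> b * (h \<bullet> b)\<^sup>2)"
        by (intro sum.cong) (auto simp: \<mu>'_def)
      moreover have "(h \<bullet> n)\<^sup>2 / 4 \<le> (h \<bullet> n)\<^sup>2 / 2" by simp
      ultimately show ?thesis unfolding g_eq sum_\<mu>' add_divide_distrib by linarith
    qed
    show "(LINT y:UNIV - A|lborel. exp (- \<beta> * g y)) / (LINT y:UNIV|lborel. exp (- \<beta> * g y)) \<le> K * exp (- c' * \<beta>)"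
      if "\<beta> > \<beta>0" for \<beta>
    proof -
      have "\<beta> > 0" using that tail(2) by simp
      then show ?thesis using tail(3)[OF that, unfolded full[OF \<open>\<beta> > 0\<close>] far[OF \<open>\<beta> > 0\<close>]] by simp
    qed
  qed (use tail in auto)
  \<comment> \<open>The artificial direction contributes sqrt (2 pi), which the normalization of the
    weight takes away again.\<close>
  have prod: "(\<Prod>b\<in>B. sqrt (2 * pi / \<mu>' b)) / sqrt (2 * pi) = (\<Prod>b\<in>B - {n}. sqrt (2 * pi / \<mu> b))"
    using D(1) n by (subst prod.remove[of _ n]) (auto simp: \<mu>'_def intro!: prod.cong)
  have "((\<lambda>\<beta>. sqrt \<beta> ^ DIM('a) * exp (\<beta> * g a) * (LINT x:UNIV|lborel. exp (- \<beta> * g x)) / sqrt (2 * pi))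
    \<longlongrightarrow> (\<Prod>b\<in>B - {n}. sqrt (2 * pi / \<mu> b))) at_top"
    unfolding prod[symmetric] by (intro tendsto_divide main tendsto_const) auto
  moreover have "\<forall>\<^sub>F \<beta> in at_top. sqrt \<beta> ^ DIM('a) * exp (\<beta> * g a) * (LINT x:UNIV|lborel. exp (- \<beta> * g x)) / sqrt (2 * pi)
     = sqrt \<beta> ^ DIM('a) * exp (\<beta> * f a) * (?D \<beta> / sqrt \<beta>)"
    using eventually_gt_at_top[of "0::real"]
  proof eventually_elim
    case (elim \<beta>)
    then show ?case unfolding full[OF elim] by (simp add: ga real_sqrt_divide)
  qed
  ultimately show ?thesis by (rule Lim_transform_eventually)
qed

section \<open>Assembling the prefactor\<close>

context lattice_chain
begin

text \<open>The sign \<open>s\<close> and the minimizer \<open>um\<close> are arbitrary, so that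
  both wells are instances. Signs are assumed for the lowest relevant eigenvalues; monotonicity of
  the spectrum gives the others.\<close>

lemma residency_time_asymptotics:
  assumes bdd: "bdd_below (range V)" and growth: "\<exists>C>0. \<forall>\<^sub>F x in at_infinity. V x \<ge> C * x\<^sup>2"
    and saddle: "critical_point U us" "spectrum_at bc site \<delta> V us lam_s \<phi>" "0 < lam_s 2"
    and minimizer: "local_minimizer U um" "um \<in> half_space s us (\<phi> 1)"
      "spectrum_at bc site \<delta> V um lam \<psi>" "0 < lam 1"
    and conc_s: "concentrates (hyperplane_measure us (\<phi> 1)) (hyperplane us (\<phi> 1)) U us"
    and conc: "concentrates lborel (half_space s us (\<phi> 1)) U um"
  shows "residency_time U us (\<phi> 1) s \<sim>[at_top]
      (\<lambda>\<beta>. 2 * pi * ((\<Prod>j = 2..CARD('n). sqrt (lam_s j)) / (\<Prod>j = 1..CARD('n). sqrt (lam j))) *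
            exp (\<beta> * (U us - U um)))"
proof -
  let ?I = "{1..CARD('n)}"
  define N where "N = real CARD('n)"
  have N: "N > 0" by (simp add: N_def)
  have card: "CARD('n) \<ge> 1" by (simp add: Suc_le_eq)
  have [measurable]: "U \<in> borel_measurable borel"
    by (intro borel_measurable_continuous_onI continuous_potential_energy)
  define bs where "bs k = \<phi> k /\<^sub>R norm (\<phi> k)" for k
  define bm where "bm k = \<psi> k /\<^sub>R norm (\<psi> k)" for k
  note Bs = eigenvector_basis[OF saddle(2), folded bs_def]
  note Bm = eigenvector_basis[OF minimizer(3), folded bm_def]
  have \<phi>1: "\<phi> 1 \<noteq> 0" using saddle(2) card by (auto simp: spectrum_at_def eigenpair_def)
  have lam_pos: "lam k > 0" if "k \<in> ?I" for k
    using that minimizer(3,4) strict_mono_on_leD[of ?I lam 1 k] by (auto simp: spectrum_at_def)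
  have lam_s_pos: "lam_s k > 0" if "k \<in> {2..CARD('n)}" for k
    using that saddle(2,3) strict_mono_on_leD[of ?I lam_s 2 k] by (auto simp: spectrum_at_def)
  obtain k d where coercive_s: "k > 0" "\<And>u. k * (norm (u - us))\<^sup>2 - d \<le> U u"
    using potential_energy_coercive[OF bdd growth, of us] by blast
  obtain k' d' where coercive_m: "k' > 0" "\<And>u. k' * (norm (u - um))\<^sup>2 - d' \<le> U u"
    using potential_energy_coercive[OF bdd growth, of um] by blast
  define I where "I \<beta> = (LINT u:half_space s us (\<phi> 1)|lborel. exp (- \<beta> * U u))" for \<beta>
  define Y where "Y \<beta> = (LINT u:hyperplane us (\<phi> 1)|hyperplane_measure us (\<phi> 1). exp (- \<beta> * U u))" for \<beta>
  define Pm where "Pm = (\<Prod>j\<in>?I. sqrt (lam j))"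
  define Ps where "Ps = (\<Prod>j = 2..CARD('n). sqrt (lam_s j))"
  have Pm: "Pm > 0" using lam_pos by (auto simp: Pm_def intro!: prod_pos)
  have Ps: "Ps > 0" using lam_s_pos by (auto simp: Ps_def intro!: prod_pos)
  \<comment> \<open>A direction in which the Hessian of the energy has eigenvalue l / N contributes
    sqrt (2 pi N / l) = r / sqrt l.\<close>
  define r where "r = sqrt (2 * pi * N)"
  have r: "r > 0" using N by (simp add: r_def)

  have limI: "((\<lambda>\<beta>. sqrt \<beta> ^ CARD('n) * exp (\<beta> * U um) * I \<beta>) \<longlongrightarrow> r ^ CARD('n) / Pm) at_top"
  proof -
    have "open (half_space s us (\<phi> 1))"
      unfolding half_space_def by (intro open_Collect_less continuous_intros)
    then have "((\<lambda>\<beta>. sqrt \<beta> ^ DIM(real ^ 'n) * exp (\<beta> * U um) * I \<beta>)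
       \<longlongrightarrow> (\<Prod>b\<in>bm ` ?I. sqrt (2 * pi / hessian_form um b b))) at_top"
      unfolding I_def
      \<comment> \<open>The Hessian form is rewritten to its diagonal expression in the eigenbasis,
        the shape that the Laplace lemma expects.\<close>
      using back_subst[of "quadratic_expansion U um",
          OF quadratic_expansion_potential_energy[OF critical_point_local_minimizer[OF minimizer(1)]] ext, OF Bm(4)]
      by (intro laplace_open_set[OF Bm(1) _ _ _ _ minimizer(2) coercive_m conc])
         (use N in \<open>auto simp: Bm(3) lam_pos\<close>)
    moreover have "(\<Prod>b\<in>bm ` ?I. sqrt (2 * pi / hessian_form um b b)) = (\<Prod>j\<in>?I. r / sqrt (lam j))"
      unfolding prod.reindex[OF Bm(2)] comp_def
      by (intro prod.cong refl) (simp add: Bm(3) r_def N_def real_sqrt_divide)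
    ultimately show ?thesis by (simp add: prod_dividef Pm_def)
  qed

  \<comment> \<open>Dividing by \<open>sqrt \<beta>\<close> accounts for the missing dimension: N -
    1 Gaussian directions remain, whence the power of \<open>r\<close>.\<close>
  have limY: "((\<lambda>\<beta>. sqrt \<beta> ^ CARD('n) * exp (\<beta> * U us) * (Y \<beta> / sqrt \<beta>)) \<longlongrightarrow> r ^ (CARD('n) - 1) / Ps) at_top"
  proof -
    have \<phi>1_eq: "\<phi> 1 = norm (\<phi> 1) *\<^sub>R bs 1" using \<phi>1 by (simp add: bs_def)
    have diff: "bs ` ?I - {bs 1} = bs ` {2..CARD('n)}"
    proof -
      have "?I - {1} = {2..CARD('n)}" by auto
      then show ?thesis using inj_on_image_set_diff[OF Bs(2), of ?I "{1}"] card by simp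
    qed
    have "((\<lambda>\<beta>. sqrt \<beta> ^ DIM(real ^ 'n) * exp (\<beta> * U us) * (Y \<beta> / sqrt \<beta>))
       \<longlongrightarrow> (\<Prod>b\<in>bs ` ?I - {bs 1}. sqrt (2 * pi / hessian_form us b b))) at_top"
    proof -
      have expansion: "quadratic_expansion U us (\<lambda>h. \<Sum>c\<in>bs ` ?I. hessian_form us c c * (h \<bullet> c)\<^sup>2)"
        by (rule back_subst[of "quadratic_expansion U us", OF quadratic_expansion_potential_energy[OF saddle(1)] ext, OF Bs(4)])
      have pos: "hessian_form us b b > 0" if "b \<in> bs ` ?I - {bs 1}" for b
        using that N unfolding diff by (auto simp: Bs(3) lam_s_pos)
      show ?thesis
        using laplace_hyperplane[OF Bs(1) _ pos _ expansion coercive_s, of "bs 1" "norm (\<phi> 1)"] conc_s card \<phi>1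
        unfolding Y_def \<phi>1_eq[symmetric] by simp
    qed
    moreover have "(\<Prod>b\<in>bs ` {2..CARD('n)}. sqrt (2 * pi / hessian_form us b b)) = (\<Prod>j = 2..CARD('n). r / sqrt (lam_s j))"
      unfolding prod.reindex[OF inj_on_subset[OF Bs(2), of "{2..CARD('n)}", simplified]] comp_def
      by (intro prod.cong refl) (simp add: Bs(3) r_def N_def real_sqrt_divide)
    ultimately show ?thesis unfolding diff by (simp add: prod_dividef Ps_def)
  qed

  let ?R = "\<lambda>\<beta>. 2 * pi * (Ps / Pm) * exp (\<beta> * (U us - U um))"
  \<comment> \<open>The quotient of the two limits, normalized to tend to 1. The two exponential
    factors combine to the Arrhenius factor, and the leftover \<open>sqrt \<beta>\<close> is the one
    in the momentum ratio.\<close>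
  have "((\<lambda>\<beta>. sqrt (2 * pi / N) / (2 * pi * (Ps / Pm)) *
      ((sqrt \<beta> ^ CARD('n) * exp (\<beta> * U um) * I \<beta>) / (sqrt \<beta> ^ CARD('n) * exp (\<beta> * U us) * (Y \<beta> / sqrt \<beta>))))
     \<longlongrightarrow> sqrt (2 * pi / N) / (2 * pi * (Ps / Pm)) * ((r ^ CARD('n) / Pm) / (r ^ (CARD('n) - 1) / Ps))) at_top"
    using r Ps by (intro tendsto_mult tendsto_divide limI limY tendsto_const) auto
  also have "sqrt (2 * pi / N) / (2 * pi * (Ps / Pm)) * ((r ^ CARD('n) / Pm) / (r ^ (CARD('n) - 1) / Ps)) = 1"
  proof -
    have "r ^ CARD('n) = r * r ^ (CARD('n) - 1)" using card by (simp flip: power_Suc)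
    then have "(r ^ CARD('n) / Pm) / (r ^ (CARD('n) - 1) / Ps) = r * (Ps / Pm)" using r by simp
    moreover have "sqrt (2 * pi / N) * r = 2 * pi"
    proof -
      have "2 * pi / N * (2 * pi * N) = (2 * pi)\<^sup>2" using N by (simp add: power2_eq_square)
      then show ?thesis unfolding r_def real_sqrt_mult[symmetric] by (simp only: real_sqrt_abs) simp
    qed
    moreover have "sqrt (2 * pi / N) / (2 * pi * (Ps / Pm)) * (r * (Ps / Pm)) = sqrt (2 * pi / N) * r / (2 * pi)"
      using Ps Pm by simp
    ultimately show ?thesis by (simp only:) simp
  qed
  finally have lim: "((\<lambda>\<beta>. sqrt (2 * pi / N) / (2 * pi * (Ps / Pm)) *
      ((sqrt \<beta> ^ CARD('n) * exp (\<beta> * U um) * I \<beta>) / (sqrt \<beta> ^ CARD('n) * exp (\<beta> * U us) * (Y \<beta> / sqrt \<beta>))))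
     \<longlongrightarrow> 1) at_top" .
  have "\<forall>\<^sub>F \<beta> in at_top. sqrt (2 * pi / N) / (2 * pi * (Ps / Pm)) *
      ((sqrt \<beta> ^ CARD('n) * exp (\<beta> * U um) * I \<beta>) / (sqrt \<beta> ^ CARD('n) * exp (\<beta> * U us) * (Y \<beta> / sqrt \<beta>)))
     = residency_time U us (\<phi> 1) s \<beta> / ?R \<beta>"
    using eventually_gt_at_top[of "0::real"]
  proof eventually_elim
    case (elim \<beta>)
    have "residency_time U us (\<phi> 1) s \<beta> = sqrt (2 * pi * \<beta> / N) * (I \<beta> / Y \<beta>)"
      unfolding I_def Y_def N_def
      by (intro residency_time_eq \<phi>1 elim integrable_exp_coercive[OF _ coercive_s(1) elim coercive_s(2)]) auto
    moreover have "sqrt (2 * pi * \<beta> / N) = sqrt (2 * pi / N) * sqrt \<beta>" by (simp flip: real_sqrt_mult)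
    moreover have "sqrt \<beta> ^ CARD('n) > 0" using elim by simp
    ultimately show ?case using Ps Pm
      by (simp add: right_diff_distrib exp_diff field_simps del: real_sqrt_gt_0_iff)
  qed
  from Lim_transform_eventually[OF lim this] show ?thesis
    unfolding Ps_def Pm_def by (rule asymp_equivI')
qed

end

theorem mainTheorem4:
  fixes V :: "real \<Rightarrow> real" and \<delta> :: real and bc :: boundary
    and site :: "nat \<Rightarrow> 'n::finite"
    and U :: "real ^ 'n \<Rightarrow> real"
    and us up um :: "real ^ 'n"
    and lam_s lam_p lam_m :: "nat \<Rightarrow> real"
    and \<phi> \<psi>p \<psi>m :: "nat \<Rightarrow> real ^ 'n"
  assumes delta: "\<delta> > 0"
    and V_smooth: "smooth_fun V"
    and V_double_well: "double_well V"
    and V_bounded_below: "bdd_below (range V)"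
    and V_growth: "\<exists>C>0. \<forall>\<^sub>F x in at_infinity. V x \<ge> C * x\<^sup>2"
    and N: "CARD('n) \<ge> 2"
    and site: "bij_betw site {1..CARD('n)} UNIV"
    and U: "U = potential_energy bc site \<delta> V"
    and saddle: "min_energy_saddle U us"
    and saddle_spectrum: "spectrum_at bc site \<delta> V us lam_s \<phi>"
    and saddle_signs: "lam_s 1 < 0" "0 < lam_s 2"
    and minimizers: "{u. local_minimizer U u} = {up, um}"
    and minimizers_regions: "(0, up) \<in> region 1 us (\<phi> 1)" "(0, um) \<in> region (-1) us (\<phi> 1)"
    and plus_spectrum: "spectrum_at bc site \<delta> V up lam_p \<psi>p" "0 < lam_p 1"
    and minus_spectrum: "spectrum_at bc site \<delta> V um lam_m \<psi>m" "0 < lam_m 1"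
    and concentration_surface:
      "concentrates (hyperplane_measure us (\<phi> 1)) (hyperplane us (\<phi> 1)) U us"
    and concentration_plus: "concentrates lborel (half_space 1 us (\<phi> 1)) U up"
    and concentration_minus: "concentrates lborel (half_space (-1) us (\<phi> 1)) U um"
  shows "(residency_time U us (\<phi> 1) 1 \<sim>[at_top]
      (\<lambda>\<beta>. 2 * pi * ((\<Prod>j = 2..CARD('n). sqrt (lam_s j)) / (\<Prod>j = 1..CARD('n). sqrt (lam_p j))) *
            exp (\<beta> * (U us - U up)))) \<and>
    (residency_time U us (\<phi> 1) (-1) \<sim>[at_top]
      (\<lambda>\<beta>. 2 * pi * ((\<Prod>j = 2..CARD('n). sqrt (lam_s j)) / (\<Prod>j = 1..CARD('n). sqrt (lam_m j))) *
            exp (\<beta> * (U us - U um))))"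
proof -
  interpret lattice_chain bc site \<delta> V using site V_smooth by unfold_locales
  have "critical_point U us" using saddle by (simp add: min_energy_saddle_def)
  moreover have "local_minimizer U up" "local_minimizer U um" using minimizers by auto
  moreover have "up \<in> half_space 1 us (\<phi> 1)" "um \<in> half_space (-1) us (\<phi> 1)"
    using minimizers_regions by (auto simp: region_def half_space_def)
  ultimately show ?thesis
    using V_bounded_below V_growth saddle_spectrum saddle_signs(2) plus_spectrum minus_spectrum
      concentration_surface concentration_plus concentration_minus
    unfolding U by (intro conjI residency_time_asymptotics)
qed

end
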